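(* Let $D=(V,A)$ be a countable digraph (multiple edges and loops allowed) and let $s\neq t\in V$. Suppose that for every $v\in V$ there is a finitary matroid $\mathcal{M}_v$ on the set $\mathsf{in}_D(v)$ of edges with head $v$, and let $\mathcal{M}=\bigoplus_{v\in V}\mathcal{M}_v$ (a matroid on $A$). Then there is a system $\mathcal{P}$ of pairwise edge-disjoint $s\rightarrow t$ paths such that $\bigcup_{P\in\mathcal{P}}A(P)$ is independent in $\mathcal{M}$, and there is an edge set $C\subseteq A$ consisting of exactly one edge from each element of $\mathcal{P}$ such that $\mathsf{span}_{\mathcal{M}}(C)$ covers all $s\rightarrow t$ paths of $D$ (i.e. every $s\rightarrow t$ path in $D$ has an edge in $\mathsf{span}_{\mathcal{M}}(C)$).
   Context: Paths are finite directed paths with no repeated vertices; $A(P)$ is the edge set of the path $P$. A matroid is finitary if all its circuits are finite. $\mathsf{span}_{\mathcal{M}}(S)$ is the closure of $S$ in $\mathcal{M}$ (the union of $S$ and all elements $e$ such that $S+e$ contains a circuit through $e$, equivalently the loops of $\mathcal{M}/S$). *)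

theory Defs
  imports "Graph_Theory.Arc_Walk" "HOL-Library.Countable_Set"
begin

record 'a matroid_data =
  ground :: "'a set"
  indep :: "'a set \<Rightarrow> bool"

definition is_base :: "('a, 'z) matroid_data_scheme \<Rightarrow> 'a set \<Rightarrow> bool" where
  "is_base M B \<longleftrightarrow> indep M B \<and> (\<forall>J. indep M J \<and> B \<subseteq> J \<longrightarrow> J = B)"

text \<open>
  Possibly infinite matroids, by the independence axioms of Bruhn, Diestel, Kriesell, Pendavingh
  and Wollan. The ground set need not be finite.
\<close>

locale matroid =
  fixes M :: "('a, 'z) matroid_data_scheme"
  assumes indep_subset_ground: "indep M J \<Longrightarrow> J \<subseteq> ground M"
    and indep_empty: "indep M {}"
    and indep_subset: "indep M J \<Longrightarrow> K \<subseteq> J \<Longrightarrow> indep M K"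
    and indep_augment:
      "indep M J \<Longrightarrow> \<not> is_base M J \<Longrightarrow> is_base M B \<Longrightarrow> \<exists>x\<in>B - J. indep M (insert x J)"
    and indep_maximal:
      "indep M J \<Longrightarrow> J \<subseteq> X \<Longrightarrow> X \<subseteq> ground M \<Longrightarrow>
        \<exists>K. J \<subseteq> K \<and> K \<subseteq> X \<and> indep M K \<and> (\<forall>L. indep M L \<and> K \<subseteq> L \<and> L \<subseteq> X \<longrightarrow> L = K)"

definition circuit :: "('a, 'z) matroid_data_scheme \<Rightarrow> 'a set \<Rightarrow> bool" where
  "circuit M C \<longleftrightarrow> C \<subseteq> ground M \<and> \<not> indep M C \<and> (\<forall>K. K \<subset> C \<longrightarrow> indep M K)"

locale finitary_matroid = matroid +
  assumes circuit_finite: "circuit M C \<Longrightarrow> finite C"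

definition matroid_span :: "('a, 'z) matroid_data_scheme \<Rightarrow> 'a set \<Rightarrow> 'a set" where
  "matroid_span M S = S \<union> {e. \<exists>C. circuit M C \<and> e \<in> C \<and> C \<subseteq> insert e S}"

text \<open>The summands are meant to have pairwise disjoint ground sets.\<close>

definition direct_sum :: "'i set \<Rightarrow> ('i \<Rightarrow> 'a matroid_data) \<Rightarrow> 'a matroid_data" where
  "direct_sum I M =
    \<lparr>ground = (\<Union>i\<in>I. ground (M i)),
     indep = (\<lambda>J. J \<subseteq> (\<Union>i\<in>I. ground (M i)) \<and> (\<forall>i\<in>I. indep (M i) (J \<inter> ground (M i))))\<rparr>"

lemma ground_direct_sum [simp]: "ground (direct_sum I M) = (\<Union>i\<in>I. ground (M i))"
  by (simp add: direct_sum_def)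

lemma indep_direct_sum:
  "indep (direct_sum I M) J \<longleftrightarrow>
    J \<subseteq> (\<Union>i\<in>I. ground (M i)) \<and> (\<forall>i\<in>I. indep (M i) (J \<inter> ground (M i)))"
  by (simp add: direct_sum_def)

lemma matroid_direct_sum:
  assumes mat: "\<And>i. i \<in> I \<Longrightarrow> matroid (M i)"
    and disj: "\<And>i j. i \<in> I \<Longrightarrow> j \<in> I \<Longrightarrow> i \<noteq> j \<Longrightarrow> ground (M i) \<inter> ground (M j) = {}"
  shows "matroid (direct_sum I M)"
proof -
  have glue: "(\<Union>i\<in>I. f i) \<inter> ground (M j) = f j"
    if f: "\<And>i. i \<in> I \<Longrightarrow> f i \<subseteq> ground (M i)" and j: "j \<in> I" for f j
    using f j disj by blast
  have swap: "indep (direct_sum I M) ((J - ground (M i)) \<union> K)"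
    if J: "indep (direct_sum I M) J" and i: "i \<in> I" and K: "indep (M i) K" for J K i
  proof -
    have Ki: "K \<subseteq> ground (M i)"
      using matroid.indep_subset_ground[OF mat[OF i] K] .
    have "indep (M j) (((J - ground (M i)) \<union> K) \<inter> ground (M j))" if j: "j \<in> I" for j
    proof (cases "j = i")
      case True
      have "((J - ground (M i)) \<union> K) \<inter> ground (M i) = K" using Ki by blast
      then show ?thesis using K True by simp
    next
      case False
      then have "((J - ground (M i)) \<union> K) \<inter> ground (M j) = J \<inter> ground (M j)"
        using Ki disj[OF i j] by blast
      then show ?thesis using J j by (simp add: indep_direct_sum)
    qed
    moreover have "(J - ground (M i)) \<union> K \<subseteq> (\<Union>i\<in>I. ground (M i))"
      using J Ki i by (auto simp: indep_direct_sum)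
    ultimately show ?thesis by (simp add: indep_direct_sum)
  qed
  show ?thesis
  proof
    fix J assume "indep (direct_sum I M) J"
    then show "J \<subseteq> ground (direct_sum I M)" by (simp add: indep_direct_sum)
  next
    show "indep (direct_sum I M) {}"
      using mat by (auto simp: indep_direct_sum intro: matroid.indep_empty)
  next
    fix J K assume J: "indep (direct_sum I M) J" and KJ: "K \<subseteq> J"
    have "indep (M i) (K \<inter> ground (M i))" if "i \<in> I" for i
      by (rule matroid.indep_subset[OF mat[OF that], of "J \<inter> ground (M i)"])
        (use J KJ that in \<open>auto simp: indep_direct_sum\<close>)
    then show "indep (direct_sum I M) K" using J KJ by (auto simp: indep_direct_sum)
  next
    fix J B
    assume J: "indep (direct_sum I M) J" and nb: "\<not> is_base (direct_sum I M) J"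
      and B: "is_base (direct_sum I M) B"
    have B': "indep (direct_sum I M) B" using B by (simp add: is_base_def)
    obtain L where L: "indep (direct_sum I M) L" "J \<subseteq> L" "L \<noteq> J"
      using J nb by (auto simp: is_base_def)
    then obtain x where x: "x \<in> L" "x \<notin> J" by blast
    obtain i where i: "i \<in> I" "x \<in> ground (M i)"
      using L(1) x(1) unfolding indep_direct_sum by blast
    have Ji: "indep (M i) (J \<inter> ground (M i))" and Li: "indep (M i) (L \<inter> ground (M i))"
      using J L i by (auto simp: indep_direct_sum)
    have nbi: "\<not> is_base (M i) (J \<inter> ground (M i))"
    proof
      assume "is_base (M i) (J \<inter> ground (M i))"
      then have "L \<inter> ground (M i) = J \<inter> ground (M i)"
        using Li L(2) unfolding is_base_def by blast
      then show False using x i by blast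
    qed
    have Bi: "is_base (M i) (B \<inter> ground (M i))"
      unfolding is_base_def
    proof (intro conjI allI impI)
      show "indep (M i) (B \<inter> ground (M i))" using B' i by (auto simp: indep_direct_sum)
    next
      fix K assume K: "indep (M i) K \<and> B \<inter> ground (M i) \<subseteq> K"
      have Ki: "K \<subseteq> ground (M i)" using matroid.indep_subset_ground[OF mat[OF i(1)]] K by blast
      have "indep (direct_sum I M) ((B - ground (M i)) \<union> K)" using swap[OF B' i(1)] K by blast
      moreover have "B \<subseteq> (B - ground (M i)) \<union> K" using K by blast
      ultimately have "(B - ground (M i)) \<union> K = B" using B unfolding is_base_def by blast
      then show "K = B \<inter> ground (M i)" using K Ki by blast
    qed
    obtain y where y: "y \<in> B \<inter> ground (M i) - J \<inter> ground (M i)"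
      "indep (M i) (insert y (J \<inter> ground (M i)))"
      using matroid.indep_augment[OF mat[OF i(1)] Ji nbi Bi] by blast
    have "(J - ground (M i)) \<union> insert y (J \<inter> ground (M i)) = insert y J" by blast
    then have "indep (direct_sum I M) (insert y J)" using swap[OF J i(1) y(2)] by simp
    then show "\<exists>x\<in>B - J. indep (direct_sum I M) (insert x J)" using y(1) by blast
  next
    fix J X
    assume J: "indep (direct_sum I M) J" and JX: "J \<subseteq> X" and X: "X \<subseteq> ground (direct_sum I M)"
    have "\<exists>K. J \<inter> ground (M i) \<subseteq> K \<and> K \<subseteq> X \<inter> ground (M i) \<and> indep (M i) K \<and>
        (\<forall>L. indep (M i) L \<and> K \<subseteq> L \<and> L \<subseteq> X \<inter> ground (M i) \<longrightarrow> L = K)" if i: "i \<in> I" for i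
      by (rule matroid.indep_maximal[OF mat[OF i]])
        (use J JX i in \<open>auto simp: indep_direct_sum\<close>)
    then obtain f where f: "\<And>i. i \<in> I \<Longrightarrow> J \<inter> ground (M i) \<subseteq> f i \<and> f i \<subseteq> X \<inter> ground (M i) \<and>
        indep (M i) (f i) \<and>
        (\<forall>L. indep (M i) L \<and> f i \<subseteq> L \<and> L \<subseteq> X \<inter> ground (M i) \<longrightarrow> L = f i)"
      by metis
    have Jf: "J \<inter> ground (M i) \<subseteq> f i" and fX: "f i \<subseteq> X"
      and fg: "f i \<subseteq> ground (M i)" and fI: "indep (M i) (f i)" if "i \<in> I" for i
      using f[OF that] by simp_all
    define K where "K = (\<Union>i\<in>I. f i)"
    have Ki: "K \<inter> ground (M i) = f i" if "i \<in> I" for i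
      unfolding K_def by (rule glue) (use fg that in simp_all)
    have "J \<subseteq> K"
    proof
      fix x assume x: "x \<in> J"
      moreover have "J \<subseteq> (\<Union>i\<in>I. ground (M i))" using J by (simp add: indep_direct_sum)
      ultimately obtain i where i: "i \<in> I" "x \<in> ground (M i)" by blast
      then have "x \<in> f i" using Jf x by blast
      then show "x \<in> K" using i(1) unfolding K_def by blast
    qed
    moreover have "K \<subseteq> X" unfolding K_def using fX by blast
    moreover have "indep (direct_sum I M) K"
    proof -
      have "K \<subseteq> (\<Union>i\<in>I. ground (M i))" using X \<open>K \<subseteq> X\<close> by simp
      then show ?thesis using Ki fI by (simp add: indep_direct_sum)
    qed
    moreover have "L = K" if L: "indep (direct_sum I M) L" "K \<subseteq> L" "L \<subseteq> X" for L
    proof -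
      have Lf: "L \<inter> ground (M i) = f i" if i: "i \<in> I" for i
      proof -
        have "indep (M i) (L \<inter> ground (M i))" using L(1) i by (simp add: indep_direct_sum)
        moreover have "f i \<subseteq> L \<inter> ground (M i)" using Ki[OF i] L(2) by blast
        moreover have "L \<inter> ground (M i) \<subseteq> X \<inter> ground (M i)" using L(3) by blast
        ultimately show ?thesis using f[OF i] by simp
      qed
      have Lg: "L \<subseteq> (\<Union>i\<in>I. ground (M i))" using L(1) by (simp add: indep_direct_sum)
      have "L \<subseteq> K"
      proof
        fix x assume x: "x \<in> L"
        then obtain i where i: "i \<in> I" "x \<in> ground (M i)" using Lg by blast
        then have "x \<in> f i" using x Lf[OF i(1)] by blast
        then show "x \<in> K" using i(1) unfolding K_def by blast
      qed
      then show ?thesis using L(2) by blast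
    qed
    ultimately show "\<exists>K. J \<subseteq> K \<and> K \<subseteq> X \<and> indep (direct_sum I M) K \<and>
        (\<forall>L. indep (direct_sum I M) L \<and> K \<subseteq> L \<and> L \<subseteq> X \<longrightarrow> L = K)"
      by (intro exI[of _ K]) simp
  qed
qed

end

theory Submission
  imports Defs
begin

text \<open>
  The proof adapts Aharoni's method for the countable Menger theorem. A wave is a vertex set
  \<open>T\<close> together with edge-disjoint trails inside \<open>T\<close> whose edges are independent and whose last
  edges leave \<open>T\<close> and span all edges leaving \<open>T\<close>. Adding vertices greedily along an enumeration gives
  a wave \<open>S\<close> from \<open>{s}\<close> beyond which only trivial waves exist; its last edges \<open>L\<close> become \<open>C\<close>.
  They are continued to \<open>t\<close> one at a time. To continue \<open>e \<in> L\<close>, move it and then further edges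
  reachable from it to a set \<open>X\<close> that is deleted and contracted, passing to a maximal wave after
  each move. An augmenting argument shows that these waves never lose a root (otherwise a wave
  would already exist before the move), so the other members of \<open>L\<close> stay linked. If \<open>t\<close> were never
  reached, the limit of the waves together with the heads of \<open>X\<close> would be a wave from \<open>S\<close> that
  does not use \<open>e\<close>, contradicting the choice of \<open>S\<close>.
\<close>

section \<open>Finitary matroids\<close>

text \<open>Ranks cannot be counted in an infinite matroid, so comparison of cardinalities is
  replaced by comparison of spans: the augmenting argument tracks closures that stay fixed under
  exchanges. Waves fit the matroid because independence and span are tested separately at each head.
  A wave with side \<open>T\<close> can be glued to one starting at \<open>T\<close>: edges with
  head inside \<open>T\<close> come from the first, edges with head outside from the second, and no
  circuit mixes them. Deleting an edge keeps later trails disjoint from it, contracting it keeps the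
  final union independent; hence both are done to \<open>X\<close>. The augmenting argument starts
  from a problem whose waves are all trivial, but after one more edge joins \<open>X\<close> it
  yields only that no root is lost. Triviality may be destroyed, so a maximal wave is taken again
  before the next move. Finitariness enters when limits are formed, where independence is checked on
  finite subsets. Countability lets all choices be scheduled along sequences.\<close>

context matroid
begin

section \<open>Bases of subsets, exchange and closure\<close>

definition maximal_in :: "'a set \<Rightarrow> 'a set \<Rightarrow> bool" where
  "maximal_in X B \<longleftrightarrow> indep M B \<and> B \<subseteq> X \<and> (\<forall>L. indep M L \<and> B \<subseteq> L \<and> L \<subseteq> X \<longrightarrow> L = B)"

lemma maximal_in_exists:
  assumes "indep M J" "J \<subseteq> X" "X \<subseteq> ground M"
  obtains K where "J \<subseteq> K" "maximal_in X K"
  using indep_maximal[OF assms] unfolding maximal_in_def by blast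

lemma maximal_inD:
  assumes "maximal_in X B"
  shows "indep M B" "B \<subseteq> X" "\<And>x. x \<in> X \<Longrightarrow> indep M (insert x B) \<Longrightarrow> x \<in> B"
  using assms unfolding maximal_in_def by blast+

lemma is_base_iff: "is_base M B \<longleftrightarrow> maximal_in (ground M) B"
  unfolding is_base_def maximal_in_def using indep_subset_ground by blast

lemma augment_in:
  assumes X: "X \<subseteq> ground M" and B: "maximal_in X B"
    and I: "indep M I" "I \<subseteq> X" and nI: "\<not> maximal_in X I"
  shows "\<exists>x\<in>B - I. indep M (insert x I)"
proof -
  obtain B' where B': "B \<subseteq> B'" "is_base M B'"
  proof -
    have "indep M B" using B by (rule maximal_inD(1))
    then show ?thesis
      using maximal_in_exists[OF _ indep_subset_ground subset_refl] that is_base_iff by metis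
  qed
  have B'i: "indep M B'" using B'(2) by (simp add: is_base_def)
  have "indep M (B' \<inter> X)" using indep_subset[OF B'i] by blast
  then have BX: "B' \<inter> X = B" using B B'(1) unfolding maximal_in_def by blast
  define C0 where "C0 = B' - X"
  have gr: "I \<union> C0 \<subseteq> ground M"
    using I(2) X indep_subset_ground[OF B'i] unfolding C0_def by blast
  obtain N where N: "I \<subseteq> N" "maximal_in (I \<union> C0) N"
    using maximal_in_exists[OF I(1) _ gr] by blast
  note N' = maximal_inD[OF N(2)]
  show ?thesis
  proof (cases "is_base M N")
    case False
    then obtain x where x: "x \<in> B' - N" "indep M (insert x N)"
      using indep_augment[OF N'(1) _ B'(2)] by blast
    then have "x \<in> B - I" using N'(3) N(1) BX unfolding C0_def by blast
    moreover have "indep M (insert x I)" using indep_subset[OF x(2)] N(1) by blast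
    ultimately show ?thesis by blast
  next
    case True
    define C where "C = N - I"
    have C: "C \<subseteq> C0" using N'(2) unfolding C_def by blast
    obtain I' where I': "indep M I'" "I \<subseteq> I'" "I' \<subseteq> X" "I' \<noteq> I"
      using nI I unfolding maximal_in_def by blast
    have gr2: "I' \<union> C \<subseteq> ground M" using I'(3) X C gr by blast
    obtain K where K: "I' \<subseteq> K" "maximal_in (I' \<union> C) K"
      using maximal_in_exists[OF I'(1) _ gr2] by blast
    note K' = maximal_inD[OF K(2)]
    have Kb: "is_base M K"
    proof (rule ccontr)
      assume "\<not> is_base M K"
      then obtain x where x: "x \<in> N - K" "indep M (insert x K)"
        using indep_augment[OF K'(1) _ True] by blast
      then have "x \<in> C" using K(1) I'(2) unfolding C_def by blast
      then show False using K'(3)[of x] x by blast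
    qed
    have "\<not> C \<subseteq> K"
    proof
      assume "C \<subseteq> K"
      then have "N \<subseteq> K" using K(1) I'(2) unfolding C_def by blast
      then have "K = N" using True K'(1) unfolding is_base_def by blast
      then show False using K(1) I' N'(2) unfolding C0_def by blast
    qed
    then obtain c where c: "c \<in> C" "c \<notin> K" by blast
    define Bc where "Bc = B \<union> (K \<inter> C0)"
    have BcB: "Bc \<subseteq> B'" "c \<in> B'" "c \<notin> Bc"
      using B'(1) c C BX unfolding Bc_def C0_def by blast+
    have Bci: "indep M Bc" by (rule indep_subset[OF B'i BcB(1)])
    have "\<not> is_base M Bc" using BcB B'i unfolding is_base_def by blast
    then obtain x where x: "x \<in> K - Bc" "indep M (insert x Bc)"
      using indep_augment[OF Bci _ Kb] by blast
    have xX: "x \<in> X" using x(1) K'(2) C I'(3) unfolding Bc_def by blast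
    have "indep M (insert x B)" by (rule indep_subset[OF x(2)]) (auto simp: Bc_def)
    then have "x \<in> B" using maximal_inD(3)[OF B xX] by blast
    then show ?thesis using x(1) unfolding Bc_def by blast
  qed
qed

text \<open>\<open>C\<close> consists of the elements exchangeable for \<open>f\<close>. Were
  \<open>insert f C\<close> independent, a maximal independent subset of \<open>insert f I\<close>
  above it would omit some \<open>y\<close> of \<open>I\<close>; augmenting \<open>I - {y}\<close>
  from it shows that \<open>y\<close> is exchangeable, so it was not omitted.\<close>

lemma fundamental_circuit:
  assumes I: "indep M I" and f: "f \<in> ground M" and dep: "\<not> indep M (insert f I)"
  obtains C where "C \<subseteq> I" "\<not> indep M (insert f C)"
    "\<And>g. g \<in> C \<Longrightarrow> indep M (insert f (I - {g}))"
proof -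
  define C where "C = {g \<in> I. indep M (insert f (I - {g}))}"
  have fI: "f \<notin> I" using I dep by (metis insert_absorb)
  have "\<not> indep M (insert f C)"
  proof
    assume i: "indep M (insert f C)"
    have gr: "insert f I \<subseteq> ground M" using f indep_subset_ground[OF I] by blast
    obtain K where K: "insert f C \<subseteq> K" "maximal_in (insert f I) K"
    proof -
      have *: "insert f C \<subseteq> insert f I" unfolding C_def by auto
      show ?thesis by (rule maximal_in_exists[OF i * gr]) (rule that)
    qed
    note K' = maximal_inD[OF K(2)]
    have "\<not> I \<subseteq> K"
    proof
      assume "I \<subseteq> K"
      then have "insert f I \<subseteq> K" using K(1) by blast
      then show False using indep_subset[OF K'(1)] dep by metis
    qed
    then obtain y where y: "y \<in> I" "y \<notin> K" by blast
    have iy: "indep M (I - {y})" using indep_subset[OF I] by blast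
    have "\<not> maximal_in (insert f I) (I - {y})"
      using I y(1) unfolding maximal_in_def by blast
    then obtain x where x: "x \<in> K - (I - {y})" "indep M (insert x (I - {y}))"
      using augment_in[OF gr K(2) iy] by blast
    then have "x = f" using K'(2) y by blast
    then show False using x(2) y K(1) unfolding C_def by blast
  qed
  then show ?thesis using that[of C] unfolding C_def by blast
qed

lemma fundamental_circuit_is_circuit:
  assumes "indep M I" "f \<in> ground M" "C \<subseteq> I" "\<not> indep M (insert f C)"
    "\<And>g. g \<in> C \<Longrightarrow> indep M (insert f (I - {g}))"
  shows "circuit M (insert f C)"
  unfolding circuit_def
proof (intro conjI allI impI)
  show "insert f C \<subseteq> ground M" using assms(1-3) indep_subset_ground by blast
  show "\<not> indep M (insert f C)" by fact
next
  fix K assume K: "K \<subset> insert f C"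
  show "indep M K"
  proof (cases "f \<in> K")
    case True
    then obtain g where "g \<in> C" "g \<notin> K" using K by blast
    then show ?thesis using indep_subset[OF assms(5)] K assms(3) by blast
  next
    case False
    then show ?thesis using indep_subset[OF assms(1)] K assms(3) by blast
  qed
qed

text \<open>Only meaningful for independent \<open>I\<close>, where it coincides with \<^const>\<open>matroid_span\<close>.\<close>

definition cl :: "'a set \<Rightarrow> 'a set" where
  "cl I = {e \<in> ground M. e \<in> I \<or> \<not> indep M (insert e I)}"

lemma cl_mono: "I \<subseteq> J \<Longrightarrow> cl I \<subseteq> cl J"
  unfolding cl_def using indep_subset[OF _ insert_mono] by auto

lemma subset_cl: "I \<subseteq> ground M \<Longrightarrow> I \<subseteq> cl I"
  unfolding cl_def by blast

text \<open>If \<open>J\<close> spans \<open>e\<close>, a maximal independent subset of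
  \<open>I \<union> J\<close> above \<open>J\<close> stays maximal when \<open>e\<close> is allowed.
  If \<open>I\<close> did not span \<open>e\<close>, that set would augment \<open>I\<close> by an
  element of \<open>J\<close>, against \<open>J \<subseteq> cl I\<close>.\<close>

lemma cl_trans:
  assumes I: "indep M I" and J: "indep M J" and JI: "J \<subseteq> cl I"
  shows "cl J \<subseteq> cl I"
proof
  fix e assume e: "e \<in> cl J"
  show "e \<in> cl I"
  proof (rule ccontr)
    assume n: "e \<notin> cl I"
    have eg: "e \<in> ground M" using e by (simp add: cl_def)
    have eI: "e \<notin> I" "indep M (insert e I)" using n eg by (auto simp: cl_def)
    have eJ: "e \<notin> J" "\<not> indep M (insert e J)" using n e JI by (auto simp: cl_def)
    have gr: "insert e (I \<union> J) \<subseteq> ground M"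
      using eg I J indep_subset_ground by blast
    obtain K where K: "J \<subseteq> K" "maximal_in (I \<union> J) K"
      using maximal_in_exists[OF J, of "I \<union> J"] gr by blast
    have "maximal_in (insert e (I \<union> J)) K"
      unfolding maximal_in_def
    proof (intro conjI allI impI)
      fix L assume L: "indep M L \<and> K \<subseteq> L \<and> L \<subseteq> insert e (I \<union> J)"
      have "e \<notin> L"
      proof
        assume "e \<in> L"
        then have "insert e J \<subseteq> L" using L K(1) by blast
        then show False using indep_subset L eJ(2) by metis
      qed
      then show "L = K" using L K(2) unfolding maximal_in_def by blast
    qed (use K(2) in \<open>auto simp: maximal_in_def\<close>)
    moreover have "\<not> maximal_in (insert e (I \<union> J)) I"
      using eI unfolding maximal_in_def by blast
    ultimately obtain x where x: "x \<in> K - I" "indep M (insert x I)"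
      using augment_in[OF gr _ I] by blast
    then have "x \<in> J" using maximal_inD(2)[OF K(2)] by blast
    then show False using x JI by (auto simp: cl_def)
  qed
qed

lemma cl_subset_span:
  assumes I: "indep M I"
  shows "cl I \<subseteq> matroid_span M I"
proof
  fix e assume e: "e \<in> cl I"
  show "e \<in> matroid_span M I"
  proof (cases "e \<in> I")
    case False
    then have "e \<in> ground M" "\<not> indep M (insert e I)" using e by (auto simp: cl_def)
    from I this obtain C where "C \<subseteq> I" "\<not> indep M (insert e C)"
      "\<And>g. g \<in> C \<Longrightarrow> indep M (insert e (I - {g}))" using fundamental_circuit by blast
    then have "circuit M (insert e C)" "insert e C \<subseteq> insert e I"
      using fundamental_circuit_is_circuit[OF I \<open>e \<in> ground M\<close>] by auto
    then show ?thesis unfolding matroid_span_def by blast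
  qed (simp add: matroid_span_def)
qed

text \<open>An element of \<open>U\<close> outside \<open>C\<close> that is spanned by
  \<open>C\<close> would close a circuit inside \<open>U\<close>. This is what finally keeps the
  chosen edge on a walk when the walk is shortened to a path.\<close>

lemma span_Int_indep:
  assumes "indep M U" "C \<subseteq> U"
  shows "matroid_span M C \<inter> U \<subseteq> C"
proof
  fix e assume e: "e \<in> matroid_span M C \<inter> U"
  show "e \<in> C"
  proof (rule ccontr)
    assume "e \<notin> C"
    then obtain Z where Z: "circuit M Z" "Z \<subseteq> insert e C"
      using e unfolding matroid_span_def by blast
    then have "Z \<subseteq> U" using assms(2) e by blast
    then show False using Z(1) indep_subset[OF assms(1)] unfolding circuit_def by blast
  qed
qed

end

text \<open>A dependent set contains a fundamental circuit over one of its maximal independent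
  subsets, and this circuit is a finite dependent subset. Thus independence survives limits.\<close>

lemma (in finitary_matroid) indep_finite_character:
  assumes J: "J \<subseteq> ground M" and fin: "\<And>F. finite F \<Longrightarrow> F \<subseteq> J \<Longrightarrow> indep M F"
  shows "indep M J"
proof (rule ccontr)
  assume dep: "\<not> indep M J"
  obtain I where I: "maximal_in J I"
    using maximal_in_exists[OF indep_empty _ J] by blast
  note I' = maximal_inD[OF I]
  obtain f where f: "f \<in> J" "f \<notin> I" using I'(1,2) dep by (metis subset_antisym subsetI)
  have "f \<in> ground M" "\<not> indep M (insert f I)" using f J I'(3) by blast+
  with I'(1) obtain C where C: "C \<subseteq> I" "\<not> indep M (insert f C)"
    "\<And>g. g \<in> C \<Longrightarrow> indep M (insert f (I - {g}))" using fundamental_circuit by blast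
  have "circuit M (insert f C)"
    by (rule fundamental_circuit_is_circuit[OF I'(1) \<open>f \<in> ground M\<close>]) (fact C)+
  then have "finite (insert f C)" by (rule circuit_finite)
  then show False using fin[of "insert f C"] C f(1) I'(2) by blast
qed

section \<open>Waves\<close>

text \<open>\<open>indep_local\<close> expresses the direct sum over heads without naming the
  summands.\<close>

locale matroid_network = wf_digraph D + finitary_matroid N
  for D :: "('v, 'e) pre_digraph" and N :: "'e matroid_data" +
  fixes t :: 'v
  assumes ground_N: "ground N = arcs D"
    and indep_local: "J \<subseteq> arcs D \<Longrightarrow> (\<And>v. indep N (J \<inter> {a. head D a = v})) \<Longrightarrow> indep N J"
    and countable_verts: "countable (verts D)"
    and countable_arcs: "countable (arcs D)"
begin

definition cut :: "'v set \<Rightarrow> 'e set" where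
  "cut T = {a \<in> arcs D. tail D a \<in> T \<and> head D a \<notin> T}"

text \<open>
  \<open>p u\<close> is the edge preceding \<open>u\<close> on its trail. The finite \<open>p\<close>-closed sets exclude infinite backward
  trails but permit cycles and dead ends; an edge that precedes no other cannot lie on a cycle,
  so following \<open>p\<close> from it ends in \<open>L\<close>.
\<close>

definition linking :: "'e set \<Rightarrow> 'e set \<Rightarrow> ('e \<Rightarrow> 'e) \<Rightarrow> bool" where
  "linking L U p \<longleftrightarrow>
    (\<forall>u\<in>U - L. p u \<in> U \<and> head D (p u) = tail D u) \<and>
    inj_on p (U - L) \<and>
    (\<forall>u\<in>U. \<exists>F. finite F \<and> u \<in> F \<and> F \<subseteq> U \<and> p ` (F - L) \<subseteq> F)"

text \<open>
  The problem left after contracting \<open>S\<close> to a source, keeping only the edges \<open>L\<close> out of it, and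
  deleting and contracting the edges \<open>X\<close>.
\<close>

definition state :: "'v set \<Rightarrow> 'e set \<Rightarrow> 'e set \<Rightarrow> bool" where
  "state S L X \<longleftrightarrow> S \<subseteq> verts D \<and> t \<notin> S \<and> L \<subseteq> cut S \<and> X \<subseteq> arcs D \<and> L \<inter> X = {} \<and>
    indep N (L \<union> X) \<and> cut S \<subseteq> cl (L \<union> X)"

text \<open>Trails leave \<open>S\<close> only through \<open>L\<close> but need not use all of
  \<open>L\<close>, and they may stop inside \<open>T\<close>. \<open>X\<close> is avoided
  (deletion) and joined to every set tested for independence or span (contraction).\<close>

definition wave :: "'v set \<Rightarrow> 'e set \<Rightarrow> 'e set \<Rightarrow> 'v set \<Rightarrow> 'e set \<Rightarrow> ('e \<Rightarrow> 'e) \<Rightarrow> bool" where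
  "wave S L X T U p \<longleftrightarrow> S \<subseteq> T \<and> T \<subseteq> verts D \<and> t \<notin> T \<and> U \<subseteq> arcs D \<and> U \<inter> X = {} \<and>
    (\<forall>u\<in>U. tail D u \<in> T \<and> head D u \<notin> S \<and> tail D u \<noteq> head D u \<and> (u \<in> L \<or> tail D u \<notin> S)) \<and>
    indep N (U \<union> X) \<and> cut T \<subseteq> cl ((U \<inter> cut T) \<union> X) \<and> linking L U p"

text \<open>
  Keeping the members of \<open>L\<close> that leave \<open>T\<close> makes the end edges with head outside all sides of a chain
  of waves increase along the chain, so that the chain has a limit.
\<close>

definition kept_wave :: "'v set \<Rightarrow> 'e set \<Rightarrow> 'e set \<Rightarrow> 'v set \<Rightarrow> 'e set \<Rightarrow> ('e \<Rightarrow> 'e) \<Rightarrow> bool" where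
  "kept_wave S L X T U p \<longleftrightarrow> wave S L X T U p \<and> L \<inter> cut T \<subseteq> U"

text \<open>Edges entering \<open>T\<close> are frozen, and ends whose head stays outside
  \<open>T'\<close> survive. Only an edge of \<open>U\<close> with head in \<open>T' - T\<close> may
  disappear, so predecessors are compared on \<open>U \<inter> U'\<close> alone.\<close>

definition ext :: "'v set \<Rightarrow> 'e set \<Rightarrow> ('e \<Rightarrow> 'e) \<Rightarrow> 'v set \<Rightarrow> 'e set \<Rightarrow> ('e \<Rightarrow> 'e) \<Rightarrow> bool" where
  "ext T U p T' U' p' \<longleftrightarrow> T \<subseteq> T' \<and> (\<forall>u. head D u \<in> T \<longrightarrow> (u \<in> U \<longleftrightarrow> u \<in> U')) \<and>
    (\<forall>u\<in>U. head D u \<notin> T' \<longrightarrow> u \<in> U') \<and> (\<forall>u\<in>U \<inter> U'. p u = p' u)"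

section \<open>Independence and span, head by head\<close>

lemma indep_localI:
  assumes "J \<subseteq> arcs D" "\<And>v. \<exists>K. indep N K \<and> J \<inter> {a. head D a = v} \<subseteq> K"
  shows "indep N J"
proof (rule indep_local[OF assms(1)])
  fix v
  obtain K where K: "indep N K" "J \<inter> {a. head D a = v} \<subseteq> K" using assms(2) by blast
  show "indep N (J \<inter> {a. head D a = v})" by (rule indep_subset[OF K])
qed

text \<open>Whether \<open>e\<close> is spanned depends only on edges entering the same vertex. This
  transfers span between waves that agree at that vertex although their sides or forbidden sets
  differ.\<close>

lemma cl_localD:
  assumes I: "indep N I" and e: "e \<in> cl I" and IJ: "I \<inter> {a. head D a = head D e} \<subseteq> J"
  shows "e \<in> cl J"
proof -
  let ?J = "I \<inter> {a. head D a = head D e}"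
  have ea: "e \<in> arcs D" using e by (simp add: cl_def ground_N)
  have "e \<in> cl ?J"
  proof (cases "e \<in> I")
    case True
    then show ?thesis using ea by (simp add: cl_def ground_N)
  next
    case False
    then have dep: "\<not> indep N (insert e I)" using e by (simp add: cl_def)
    have "\<not> indep N (insert e ?J)"
    proof
      assume i: "indep N (insert e ?J)"
      have "indep N (insert e I)"
      proof (rule indep_localI)
        show "insert e I \<subseteq> arcs D" using ea indep_subset_ground[OF I] ground_N by blast
        fix v
        show "\<exists>K. indep N K \<and> insert e I \<inter> {a. head D a = v} \<subseteq> K"
        proof (cases "v = head D e")
          case True
          then show ?thesis using i by (intro exI[of _ "insert e ?J"]) auto
        next
          case False
          then show ?thesis using I by (intro exI[of _ I]) auto
        qed
      qed
      then show False using dep by blast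
    qed
    then show ?thesis using ea by (simp add: cl_def ground_N)
  qed
  then show ?thesis using cl_mono[OF IJ] by blast
qed

lemma linking_restrict:
  assumes l: "linking L U p" and "U' \<subseteq> U" "\<And>u. u \<in> U' \<Longrightarrow> u \<notin> L \<Longrightarrow> p u \<in> U'"
  shows "linking L U' p"
  unfolding linking_def
proof (intro conjI ballI)
  fix u assume "u \<in> U' - L"
  then show "p u \<in> U'" "head D (p u) = tail D u"
    using assms unfolding linking_def by auto
next
  have "inj_on p (U - L)" using l unfolding linking_def by blast
  then show "inj_on p (U' - L)" by (rule inj_on_subset) (use assms(2) in auto)
next
  fix u assume u: "u \<in> U'"
  then have "u \<in> U" using assms(2) by auto
  then obtain F where "finite F" "u \<in> F" "F \<subseteq> U" "p ` (F - L) \<subseteq> F"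
    using l unfolding linking_def by blast
  then show "\<exists>F. finite F \<and> u \<in> F \<and> F \<subseteq> U' \<and> p ` (F - L) \<subseteq> F"
    using u assms(3) by (intro exI[of _ "F \<inter> U'"]) auto
qed

lemma linking_add_roots:
  assumes l: "linking L U p" and K: "K \<subseteq> L"
  shows "linking L (U \<union> K) p"
proof -
  have eq: "(U \<union> K) - L = U - L" using K by blast
  have "\<exists>F. finite F \<and> u \<in> F \<and> F \<subseteq> U \<union> K \<and> p ` (F - L) \<subseteq> F" if u: "u \<in> U \<union> K" for u
  proof (cases "u \<in> U")
    case True
    then show ?thesis using l unfolding linking_def by (meson le_supI1)
  next
    case False
    then show ?thesis using u K by (intro exI[of _ "{u}"]) auto
  qed
  then show ?thesis using l unfolding linking_def eq by blast
qed

lemma stateD: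
  assumes "state S L X"
  shows "S \<subseteq> verts D" "t \<notin> S" "L \<subseteq> cut S" "X \<subseteq> arcs D" "L \<inter> X = {}"
    "indep N (L \<union> X)" "cut S \<subseteq> cl (L \<union> X)"
  using assms unfolding state_def by auto

lemma waveD:
  assumes "wave S L X T U p"
  shows "S \<subseteq> T" "T \<subseteq> verts D" "t \<notin> T" "U \<subseteq> arcs D" "U \<inter> X = {}"
    "\<And>u. u \<in> U \<Longrightarrow> tail D u \<in> T" "\<And>u. u \<in> U \<Longrightarrow> head D u \<notin> S"
    "\<And>u. u \<in> U \<Longrightarrow> tail D u \<noteq> head D u" "\<And>u. u \<in> U \<Longrightarrow> u \<in> L \<or> tail D u \<notin> S"
    "indep N (U \<union> X)" "cut T \<subseteq> cl ((U \<inter> cut T) \<union> X)" "linking L U p"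
  using assms unfolding wave_def by auto

lemma linkingD:
  assumes "linking L U p"
  shows "\<And>u. u \<in> U \<Longrightarrow> u \<notin> L \<Longrightarrow> p u \<in> U" "\<And>u. u \<in> U \<Longrightarrow> u \<notin> L \<Longrightarrow> head D (p u) = tail D u"
    "inj_on p (U - L)" "\<And>u. u \<in> U \<Longrightarrow> \<exists>F. finite F \<and> u \<in> F \<and> F \<subseteq> U \<and> p ` (F - L) \<subseteq> F"
  using assms unfolding linking_def by auto

lemma cutD: "a \<in> cut T \<Longrightarrow> a \<in> arcs D" "a \<in> cut T \<Longrightarrow> tail D a \<in> T" "a \<in> cut T \<Longrightarrow> head D a \<notin> T"
  "a \<in> cut T \<Longrightarrow> tail D a \<noteq> head D a"
  unfolding cut_def by auto

lemma state_of_wave: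
  assumes st: "state S L X" and w: "wave S L X T U p"
  shows "state T (U \<inter> cut T) X"
proof -
  have "indep N (U \<inter> cut T \<union> X)" by (rule indep_subset[OF waveD(10)[OF w]]) auto
  then show ?thesis
    unfolding state_def using waveD[OF w] stateD[OF st] by auto
qed

lemma trivial_wave:
  assumes st: "state S L X"
  shows "kept_wave S L X S L p"
proof -
  note st' = stateD[OF st]
  have "linking L L p" unfolding linking_def
    by (auto intro!: exI[of _ "{_}"])
  moreover have "L \<inter> cut S = L" using st'(3) by blast
  ultimately show ?thesis
    unfolding kept_wave_def wave_def using st' by (auto dest: cutD)
qed

text \<open>The ends are traded for edges of \<open>(L \<union> U) \<inter> cut T\<close> that
  contain \<open>L \<inter> cut T\<close> and form with \<open>X\<close> a maximal independent set,
  which therefore spans the old ends. Dropping ends interrupts no trail, since a predecessor has its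
  head in \<open>T\<close> and so does not leave \<open>T\<close>.\<close>

lemma keep_wave:
  assumes st: "state S L X" and w: "wave S L X T U p"
  shows "\<exists>U'. kept_wave S L X T U' p"
proof -
  note st' = stateD[OF st] and w' = waveD[OF w]
  have gr: "(L \<union> U) \<inter> cut T \<union> X \<subseteq> ground N" using st'(4) cutD(1) ground_N by auto
  have "indep N (L \<inter> cut T \<union> X)" by (rule indep_subset[OF st'(6)]) auto
  then obtain K where K: "L \<inter> cut T \<union> X \<subseteq> K" "maximal_in ((L \<union> U) \<inter> cut T \<union> X) K"
    by (rule maximal_in_exists[OF _ _ gr]) auto
  note K' = maximal_inD[OF K(2)]
  define J where "J = K - X"
  have J: "J \<subseteq> (L \<union> U) \<inter> cut T" "K = J \<union> X" "J \<inter> X = {}"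
    using K'(2) K(1) unfolding J_def by auto
  define U' where "U' = (U - cut T) \<union> J"
  have UL: "U' \<subseteq> U \<union> L" using J unfolding U'_def by auto
  have Ucut: "U' \<inter> cut T = J" using J unfolding U'_def by auto
  have tl: "tail D u \<in> T" if "u \<in> U'" for u
    using that w'(6) J(1) unfolding U'_def by (auto dest: cutD)
  have "linking L (U \<union> L) p" using linking_add_roots[OF w'(12)] by auto
  then have lk: "linking L U' p"
  proof (rule linking_restrict[OF _ UL])
    fix u assume u: "u \<in> U'" "u \<notin> L"
    then have "u \<in> U" using UL by auto
    then have "p u \<in> U" "head D (p u) \<in> T"
      using linkingD(1,2)[OF w'(12)] u w'(6) by auto
    then show "p u \<in> U'" unfolding U'_def by (auto dest: cutD)
  qed
  have ind: "indep N (U' \<union> X)"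
  proof (rule indep_localI)
    show "U' \<union> X \<subseteq> arcs D" using UL w'(4) st'(3,4) cutD(1) by blast
    fix v
    show "\<exists>K. indep N K \<and> (U' \<union> X) \<inter> {a. head D a = v} \<subseteq> K"
    proof (cases "v \<in> T")
      case True
      then show ?thesis using w'(10) J(1)
        by (intro exI[of _ "U \<union> X"]) (auto simp: U'_def dest: cutD)
    next
      case False
      then show ?thesis using K'(1) J(2) w'(4,6)
        by (intro exI[of _ K]) (auto simp: U'_def cut_def)
    qed
  qed
  have JX: "indep N (J \<union> X)" using K'(1) J(2) by simp
  have UX: "indep N (U \<inter> cut T \<union> X)" by (rule indep_subset[OF w'(10)]) auto
  have "U \<inter> cut T \<union> X \<subseteq> cl (J \<union> X)"
  proof
    fix a assume a: "a \<in> U \<inter> cut T \<union> X"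
    then have "a \<in> ground N" using gr by auto
    moreover have "a \<in> (L \<union> U) \<inter> cut T \<union> X" using a by auto
    ultimately show "a \<in> cl (J \<union> X)" using K'(3)[of a] J(2) by (auto simp: cl_def)
  qed
  then have "cut T \<subseteq> cl (J \<union> X)" using cl_trans[OF JX UX] w'(11) by auto
  moreover have "U' \<inter> X = {}" using w'(5) J(3) unfolding U'_def by auto
  moreover have "head D u \<notin> S \<and> tail D u \<noteq> head D u \<and> (u \<in> L \<or> tail D u \<notin> S)" if "u \<in> U'" for u
  proof (cases "u \<in> L")
    case True
    then show ?thesis using st'(3) by (auto dest: cutD)
  next
    case False
    then have "u \<in> U" using that UL by auto
    then show ?thesis using w'(7,8,9) by auto
  qed
  moreover have "U' \<subseteq> arcs D" using UL w'(4) st'(3) cutD(1) by blast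
  ultimately have "wave S L X T U' p"
    unfolding wave_def Ucut using w'(1,2,3) tl ind lk by auto
  moreover have "L \<inter> cut T \<subseteq> U'"
    using K(1) J(2) st'(5) unfolding U'_def by auto
  ultimately show ?thesis unfolding kept_wave_def by blast
qed

text \<open>The new forbidden edges have heads outside \<open>T\<close>, so only the ends of the
  wave must be independent of them. Roots with head outside \<open>T\<close> are among the ends of a
  kept wave, hence the starting state survives too.\<close>

lemma wave_more_forbidden:
  assumes st: "state S L X" and w: "kept_wave S L X T U p"
    and X': "X \<subseteq> X'" "X' \<subseteq> arcs D" "\<And>x. x \<in> X' \<Longrightarrow> x \<notin> X \<Longrightarrow> head D x \<notin> T"
    and ind: "indep N (U \<inter> cut T \<union> X')" and disj: "U \<inter> cut T \<inter> X' = {}"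
  shows "kept_wave S L X' T U p" "state S L X'"
proof -
  have w0: "wave S L X T U p" "L \<inter> cut T \<subseteq> U" using w unfolding kept_wave_def by auto
  note st' = stateD[OF st] and w' = waveD[OF w0(1)]
  have Lc: "l \<in> U \<inter> cut T" if "l \<in> L" "head D l \<notin> T" for l
    using that st'(3) w0(2) w'(1) unfolding cut_def by auto
  have Uc: "u \<in> U \<inter> cut T" if "u \<in> U" "head D u \<notin> T" for u
    using that w'(4,6) unfolding cut_def by auto
  have UX: "U \<inter> X' = {}"
    using disj w'(5) X'(3) Uc by blast
  have LX: "L \<inter> X' = {}"
    using disj st'(5) X'(3) Lc by blast
  have "indep N (U \<union> X')"
  proof (rule indep_localI)
    show "U \<union> X' \<subseteq> arcs D" using w'(4) X' by auto
    fix v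
    show "\<exists>K. indep N K \<and> (U \<union> X') \<inter> {a. head D a = v} \<subseteq> K"
    proof (cases "v \<in> T")
      case True
      then show ?thesis using w'(10) X'(3) by (intro exI[of _ "U \<union> X"]) auto
    next
      case False
      then show ?thesis using ind Uc by (intro exI[of _ "U \<inter> cut T \<union> X'"]) auto
    qed
  qed
  moreover have "cut T \<subseteq> cl (U \<inter> cut T \<union> X')"
    using w'(11) cl_mono[of "U \<inter> cut T \<union> X" "U \<inter> cut T \<union> X'"] X'(1) by auto
  ultimately show "kept_wave S L X' T U p"
    unfolding kept_wave_def wave_def using w' w0(2) UX by auto
  have "indep N (L \<union> X')"
  proof (rule indep_localI)
    show "L \<union> X' \<subseteq> arcs D" using st'(3) X' cutD(1) by blast
    fix v
    show "\<exists>K. indep N K \<and> (L \<union> X') \<inter> {a. head D a = v} \<subseteq> K"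
    proof (cases "v \<in> T")
      case True
      then show ?thesis using st'(6) X'(3) by (intro exI[of _ "L \<union> X"]) auto
    next
      case False
      then show ?thesis using ind Lc by (intro exI[of _ "U \<inter> cut T \<union> X'"]) auto
    qed
  qed
  moreover have "cut S \<subseteq> cl (L \<union> X')"
    using st'(7) cl_mono[of "L \<union> X" "L \<union> X'"] X'(1) by auto
  ultimately show "state S L X'"
    unfolding state_def using st' LX X'(2) by auto
qed

section \<open>Composition and limits of waves\<close>

lemma ext_refl: "ext T U p T U p"
  unfolding ext_def by auto

lemma ext_trans:
  assumes 1: "ext T U p T' U' p'" and 2: "ext T' U' p' T'' U'' p''"
  shows "ext T U p T'' U'' p''"
proof -
  have "p u = p'' u" if u: "u \<in> U" "u \<in> U''" for u
  proof -
    have "u \<in> U'" using 1 2 u unfolding ext_def by blast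
    then show ?thesis using 1 2 u unfolding ext_def by auto
  qed
  then show ?thesis using 1 2 unfolding ext_def by blast
qed

text \<open>The two waves overlap only in edges leaving \<open>T\<close>, which are ends of the
  first and roots of the second. Edges of the second wave that are not such roots have tail outside
  \<open>T\<close>, so preferring \<open>p\<close> on \<open>U\<close> assigns predecessors
  consistently.\<close>

lemma compose_waves:
  assumes st: "state S L X" and w1: "kept_wave S L X T U p"
    and w2: "kept_wave T (U \<inter> cut T) X T' U' p'"
  defines "U'' \<equiv> {u \<in> U. head D u \<in> T} \<union> U'" and "p'' \<equiv> (\<lambda>u. if u \<in> U then p u else p' u)"
  shows "kept_wave S L X T' U'' p''" "ext T U p T' U'' p''" "U'' \<inter> cut T' = U' \<inter> cut T'"
proof -
  have k1: "wave S L X T U p" "L \<inter> cut T \<subseteq> U" using w1 unfolding kept_wave_def by auto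
  have k2: "wave T (U \<inter> cut T) X T' U' p'" "U \<inter> cut T \<inter> cut T' \<subseteq> U'"
    using w2 unfolding kept_wave_def by auto
  note st' = stateD[OF st] and w1' = waveD[OF k1(1)] and w2' = waveD[OF k2(1)]
  note l1 = linkingD[OF w1'(12)] and l2 = linkingD[OF w2'(12)]
  show cutU: "U'' \<inter> cut T' = U' \<inter> cut T'"
    using w2'(1) unfolding U''_def cut_def by auto
  have U1: "u \<in> U \<inter> cut T" if "u \<in> U" "u \<in> U'" for u
    using that w1'(4,6) w2'(7) unfolding cut_def by auto
  have tl': "tail D u \<notin> T" if "u \<in> U'" "u \<notin> U" for u using w2'(9) that by auto
  have pU: "p'' u \<in> U \<and> p'' u \<in> U'' \<and> head D (p'' u) \<in> T \<and> head D (p'' u) = tail D u \<and> p'' u = p u"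
    if "u \<in> U" "u \<in> U''" "u \<notin> L" for u
    using that l1(1,2) w1'(6) unfolding U''_def p''_def by auto
  have pU': "p'' u \<in> U' \<and> p'' u \<in> U'' \<and> head D (p'' u) \<notin> T \<and> head D (p'' u) = tail D u \<and> p'' u = p' u"
    if "u \<notin> U" "u \<in> U''" for u
  proof -
    have "u \<in> U'" using that unfolding U''_def by auto
    then show ?thesis using that l2(1,2) w2'(9) unfolding U''_def p''_def by auto
  qed
  have lk: "linking L U'' p''"
    unfolding linking_def
  proof (intro conjI ballI)
    fix u assume "u \<in> U'' - L"
    then show "p'' u \<in> U''" "head D (p'' u) = tail D u" using pU pU' by blast+
  next
    show "inj_on p'' (U'' - L)"
    proof (rule inj_onI)
      fix u v assume uv: "u \<in> U'' - L" "v \<in> U'' - L" "p'' u = p'' v"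
      show "u = v"
      proof (cases "u \<in> U")
        case True
        then have "v \<in> U" using uv pU[of u] pU'[of v] by (metis DiffD1 DiffD2)
        then have "p u = p v" using uv True unfolding p''_def by auto
        then show ?thesis using l1(3) True \<open>v \<in> U\<close> uv unfolding inj_on_def by auto
      next
        case False
        then have v: "v \<notin> U" using uv pU[of v] pU'[of u] by (metis DiffD1 DiffD2)
        then have "p' u = p' v" using uv False unfolding p''_def by auto
        moreover have "u \<in> U'" "v \<in> U'" using uv False v unfolding U''_def by auto
        ultimately show ?thesis using l2(3) False v unfolding inj_on_def by auto
      qed
    qed
  next
    have A: "\<exists>F. finite F \<and> u \<in> F \<and> F \<subseteq> U'' \<and> p'' ` (F - L) \<subseteq> F" if u: "u \<in> U" "u \<in> U''" for u
    proof -
      obtain F where F: "finite F" "u \<in> F" "F \<subseteq> U" "p ` (F - L) \<subseteq> F" using l1(4)[OF u(1)] by blast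
      have "p'' ` (F \<inter> U'' - L) \<subseteq> F \<inter> U''"
      proof
        fix y assume "y \<in> p'' ` (F \<inter> U'' - L)"
        then obtain x where x: "x \<in> F" "x \<in> U''" "x \<notin> L" "y = p'' x" by auto
        then have "x \<in> U" using F(3) by auto
        then have "p'' x = p x" "p'' x \<in> U''" using pU[of x] x by auto
        then show "y \<in> F \<inter> U''" using F(4) x by auto
      qed
      then show ?thesis using F u by (intro exI[of _ "F \<inter> U''"]) auto
    qed
    fix u assume u: "u \<in> U''"
    show "\<exists>F. finite F \<and> u \<in> F \<and> F \<subseteq> U'' \<and> p'' ` (F - L) \<subseteq> F"
    proof (cases "u \<in> U")
      case True
      then show ?thesis using A u by blast
    next
      case False
      then have "u \<in> U'" using u unfolding U''_def by auto
      then obtain F where F: "finite F" "u \<in> F" "F \<subseteq> U'" "p' ` (F - U \<inter> cut T) \<subseteq> F"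
        using l2(4)[of u] by blast
      \<comment> \<open>A finite closed set of the second wave stops at its roots; each of these is
        continued by a finite closed set of the first wave.\<close>
      have "\<forall>x\<in>F \<inter> U. \<exists>G. finite G \<and> x \<in> G \<and> G \<subseteq> U'' \<and> p'' ` (G - L) \<subseteq> G"
        using A F(3) unfolding U''_def by auto
      from bchoice[OF this] obtain G where G: "\<forall>x\<in>F \<inter> U. finite (G x) \<and> x \<in> G x \<and> G x \<subseteq> U'' \<and> p'' ` (G x - L) \<subseteq> G x"
        by blast
      let ?F = "F \<union> (\<Union>x\<in>F \<inter> U. G x)"
      have "p'' ` (?F - L) \<subseteq> ?F"
      proof
        fix y assume "y \<in> p'' ` (?F - L)"
        then obtain x where x: "x \<in> ?F" "x \<notin> L" "y = p'' x" by auto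
        show "y \<in> ?F"
        proof (cases "x \<in> (\<Union>x\<in>F \<inter> U. G x)")
          case True
          then show ?thesis using x G by blast
        next
          case nG: False
          then have xF: "x \<in> F" using x by auto
          then have "x \<notin> U" using G nG by auto
          then have "y = p' x" "x \<notin> U \<inter> cut T" using x unfolding p''_def by auto
          then show ?thesis using F(4) xF by auto
        qed
      qed
      moreover have "?F \<subseteq> U''" using F(3) G unfolding U''_def by auto
      moreover have "finite ?F" using F(1) G by auto
      ultimately show ?thesis using F(2) by (intro exI[of _ ?F]) auto
    qed
  qed
  have "indep N (U'' \<union> X)"
  proof (rule indep_localI)
    show "U'' \<union> X \<subseteq> arcs D" using w1'(4) w2'(4) st'(4) unfolding U''_def by auto
    fix v
    show "\<exists>K. indep N K \<and> (U'' \<union> X) \<inter> {a. head D a = v} \<subseteq> K"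
    proof (cases "v \<in> T")
      case True
      then show ?thesis using w1'(10) w2'(7)
        by (intro exI[of _ "U \<union> X"]) (auto simp: U''_def)
    next
      case False
      then show ?thesis using w2'(10)
        by (intro exI[of _ "U' \<union> X"]) (auto simp: U''_def)
    qed
  qed
  moreover have "tail D u \<in> T' \<and> head D u \<notin> S \<and> tail D u \<noteq> head D u \<and> (u \<in> L \<or> tail D u \<notin> S)"
    if "u \<in> U''" for u
  proof (cases "u \<in> U")
    case True
    then show ?thesis using w1'(6-9) w2'(1) by auto
  next
    case False
    then have "u \<in> U'" using that unfolding U''_def by auto
    then show ?thesis using w2'(6-9) tl' False w1'(1) by auto
  qed
  moreover have "U'' \<inter> X = {}" using w1'(5) w2'(5) unfolding U''_def by auto
  moreover have "U'' \<subseteq> arcs D" using w1'(4) w2'(4) unfolding U''_def by auto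
  ultimately have "wave S L X T' U'' p''"
    unfolding wave_def cutU using lk w1'(1) w2'(1,2,3,11) by auto
  moreover have "L \<inter> cut T' \<subseteq> U''"
  proof
    fix l assume l: "l \<in> L \<inter> cut T'"
    then have "l \<in> cut T" using st'(3) w1'(1) w2'(1) unfolding cut_def by auto
    then show "l \<in> U''" using l k1(2) k2(2) unfolding U''_def by auto
  qed
  ultimately show "kept_wave S L X T' U'' p''" unfolding kept_wave_def by blast
  show "ext T U p T' U'' p''"
    unfolding ext_def
  proof (intro conjI allI impI ballI)
    fix u assume "u \<in> U" "head D u \<notin> T'"
    then have "u \<in> U \<inter> cut T \<inter> cut T'" using w1'(4,6) w2'(1) unfolding cut_def by auto
    then show "u \<in> U''" using k2(2) unfolding U''_def by auto
  qed (use w2'(1,7) in \<open>auto simp: U''_def p''_def\<close>)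
qed

text \<open>\<open>U'\<close> collects the edges that eventually stay. An edge whose head has been
  absorbed is frozen from then on, and an end whose head is never absorbed stays as well, so the
  span of the final cut is not lost. A finite part of the limit occurs at a single stage, which
  gives independence.\<close>

lemma wave_limit:
  assumes kw: "\<And>n :: nat. kept_wave S L (X n) (T n) (U n) (p n)"
    and ex: "\<And>n. ext (T n) (U n) (p n) (T (Suc n)) (U (Suc n)) (p (Suc n))"
    and mX: "\<And>n. X n \<subseteq> X (Suc n)"
  obtains U' p' where "kept_wave S L (\<Union>n. X n) (\<Union>n. T n) U' p'"
    "\<And>n. ext (T n) (U n) (p n) (\<Union>n. T n) U' p'"
proof -
  have w: "wave S L (X n) (T n) (U n) (p n)" and kept: "L \<inter> cut (T n) \<subseteq> U n" for n
    using kw unfolding kept_wave_def by auto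
  note w' = waveD[OF w] and l = linkingD[OF waveD(12)[OF w]]
  have exm: "ext (T m) (U m) (p m) (T n) (U n) (p n)" if "m \<le> n" for m n
    using that
  proof (induction n rule: dec_induct)
    case base
    show ?case by (rule ext_refl)
  next
    case (step n)
    show ?case by (rule ext_trans[OF step.IH ex])
  qed
  have mT: "T m \<subseteq> T n" if "m \<le> n" for m n
    using exm[OF that] unfolding ext_def by blast
  have mXX: "X m \<subseteq> X n" if "m \<le> n" for m n
    using lift_Suc_mono_le[of X, OF mX that] .
  define Tw where "Tw = (\<Union>n. T n)"
  define Xw where "Xw = (\<Union>n. X n)"
  define U' where "U' = {u. \<exists>n. \<forall>m\<ge>n. u \<in> U m}"
  \<comment> \<open>All stages containing \<open>u\<close> give it the same predecessor; the least
    index only makes the choice definite.\<close>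
  define p' where "p' u = p (LEAST n. \<forall>m\<ge>n. u \<in> U m) u" for u
  have pp: "p m u = p n u" if "u \<in> U m" "u \<in> U n" for m n u
  proof (cases "m \<le> n")
    case True
    then show ?thesis using exm[OF True] that unfolding ext_def by blast
  next
    case False
    then have "n \<le> m" by simp
    then show ?thesis using exm[of n m] that unfolding ext_def by force
  qed
  have p': "p' u = p n u" if "u \<in> U'" "u \<in> U n" for u n
  proof -
    have "\<exists>n. \<forall>m\<ge>n. u \<in> U m" using that(1) unfolding U'_def by blast
    then have "\<forall>m\<ge>(LEAST n. \<forall>m\<ge>n. u \<in> U m). u \<in> U m" by (rule LeastI_ex)
    then have "u \<in> U (LEAST n. \<forall>m\<ge>n. u \<in> U m)" by blast
    then show ?thesis unfolding p'_def using pp that(2) by blast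
  qed
  have in_in: "u \<in> U'" if "head D u \<in> T n" "u \<in> U n" for u n
  proof -
    have "u \<in> U m" if "m \<ge> n" for m
      using exm[OF that] \<open>head D u \<in> T n\<close> \<open>u \<in> U n\<close> unfolding ext_def by blast
    then show ?thesis unfolding U'_def by blast
  qed
  have in_out: "u \<in> U'" if "head D u \<notin> Tw" "u \<in> U n" for u n
  proof -
    have "u \<in> U m" if "m \<ge> n" for m
    proof -
      have "head D u \<notin> T m" using \<open>head D u \<notin> Tw\<close> unfolding Tw_def by blast
      then show ?thesis using exm[OF that] \<open>u \<in> U n\<close> unfolding ext_def by blast
    qed
    then show ?thesis unfolding U'_def by blast
  qed
  have in_conv: "u \<in> U n" if hu: "head D u \<in> T n" "u \<in> U'" for u n
  proof -
    obtain k where k: "\<forall>m\<ge>k. u \<in> U m" using hu(2) unfolding U'_def by blast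
    have "u \<in> U (max k n)" using k by simp
    then show ?thesis using exm[of n "max k n"] hu(1) unfolding ext_def by auto
  qed
  have ev: "\<exists>n. \<forall>m\<ge>n. F \<subseteq> U m \<union> X m" if "finite F" "F \<subseteq> U' \<union> Xw" for F
    using that
  proof (induction F rule: finite_induct)
    case empty
    show ?case by simp
  next
    case (insert x F)
    then obtain n where n: "\<forall>m\<ge>n. F \<subseteq> U m \<union> X m" by auto
    obtain k where k: "\<forall>m\<ge>k. x \<in> U m \<union> X m"
    proof (cases "x \<in> U'")
      case True
      then show ?thesis using that unfolding U'_def by blast
    next
      case False
      then obtain k where "x \<in> X k" using insert.prems unfolding Xw_def by blast
      then have "\<forall>m\<ge>k. x \<in> U m \<union> X m" using mXX by blast
      then show ?thesis by (rule that)
    qed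
    show ?case using n k by (intro exI[of _ "max n k"]) auto
  qed
  have ev1: "\<exists>n. \<forall>m\<ge>n. u \<in> U m" if "u \<in> U'" for u using that unfolding U'_def by blast
  have exw: "ext (T n) (U n) (p n) Tw U' p'" for n
    unfolding ext_def
  proof (intro conjI allI impI ballI)
    show "T n \<subseteq> Tw" unfolding Tw_def by blast
    fix u
    show "u \<in> U n \<longleftrightarrow> u \<in> U'" if "head D u \<in> T n" using in_in in_conv that by blast
    show "u \<in> U'" if "u \<in> U n" "head D u \<notin> Tw" using in_out that by blast
    show "p n u = p' u" if "u \<in> U n \<inter> U'" using p' that by auto
  qed
  have lk: "linking L U' p'"
    unfolding linking_def
  proof (intro conjI ballI)
    fix u assume u: "u \<in> U' - L"
    then obtain n where n: "\<forall>m\<ge>n. u \<in> U m" using ev1 by blast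
    have "p' u \<in> U m" if "m \<ge> n" for m
    proof -
      have "u \<in> U m" using n that by blast
      then show ?thesis using l(1)[of u m] p'[of u m] u by auto
    qed
    then show "p' u \<in> U'" unfolding U'_def by blast
    have "u \<in> U n" using n by blast
    then show "head D (p' u) = tail D u" using l(2)[of u n] p'[of u n] u by auto
  next
    show "inj_on p' (U' - L)"
    proof (rule inj_onI)
      fix u v assume uv: "u \<in> U' - L" "v \<in> U' - L" "p' u = p' v"
      obtain n k where nk: "\<forall>m\<ge>n. u \<in> U m" "\<forall>m\<ge>k. v \<in> U m" using ev1 uv by blast
      define m where "m = max n k"
      have m: "u \<in> U m" "v \<in> U m" using nk unfolding m_def by auto
      then have "p m u = p m v" using p'[of u m] p'[of v m] uv by auto
      then show "u = v" using l(3)[of m] m uv unfolding inj_on_def by auto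
    qed
  next
    fix u assume u: "u \<in> U'"
    then obtain n where n: "\<forall>m\<ge>n. u \<in> U m" using ev1 by blast
    then have "u \<in> U n" by blast
    then obtain F where F: "finite F" "u \<in> F" "F \<subseteq> U n" "p n ` (F - L) \<subseteq> F"
      using l(4)[of u n] by blast
    have "p' ` (F \<inter> U' - L) \<subseteq> F \<inter> U'"
    proof
      fix y assume "y \<in> p' ` (F \<inter> U' - L)"
      then obtain x where x: "x \<in> F" "x \<in> U'" "x \<notin> L" "y = p' x" by blast
      have "x \<in> U n" using F(3) x by blast
      then have "y = p n x" using p' x by auto
      then have "y \<in> F" using F(4) x by blast
      obtain k where k: "\<forall>m\<ge>k. x \<in> U m" using ev1 x by blast
      have "y \<in> U m" if "m \<ge> k" for m
        using l(1)[of x m] p'[of x m] x k that by auto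
      then have "y \<in> U'" unfolding U'_def by blast
      then show "y \<in> F \<inter> U'" using \<open>y \<in> F\<close> by blast
    qed
    then show "\<exists>F. finite F \<and> u \<in> F \<and> F \<subseteq> U' \<and> p' ` (F - L) \<subseteq> F"
      using F u by (intro exI[of _ "F \<inter> U'"]) auto
  qed
  have Ua: "\<exists>n. u \<in> U n" if "u \<in> U'" for u using ev1[OF that] by blast
  have ind: "indep N (U' \<union> Xw)"
  proof (rule indep_finite_character)
    show "U' \<union> Xw \<subseteq> ground N"
    proof
      fix x assume "x \<in> U' \<union> Xw"
      then have "\<exists>n. x \<in> U n \<union> X n" using Ua unfolding Xw_def by blast
      then show "x \<in> ground N" using w'(10) indep_subset_ground by blast
    qed
    fix F assume "finite F" "F \<subseteq> U' \<union> Xw"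
    then obtain n where "\<forall>m\<ge>n. F \<subseteq> U m \<union> X m" using ev by blast
    then have "F \<subseteq> U n \<union> X n" by blast
    then show "indep N F" by (rule indep_subset[OF w'(10)])
  qed
  have disj: "U' \<inter> Xw = {}"
  proof (rule ccontr)
    assume "U' \<inter> Xw \<noteq> {}"
    then obtain u k where u: "u \<in> U'" "u \<in> X k" unfolding Xw_def by blast
    then obtain n where n: "\<forall>m\<ge>n. u \<in> U m" using ev1 by blast
    have "u \<in> U (max n k)" "u \<in> X (max n k)" using n mXX[of k "max n k"] u by auto
    then show False using w'(5) by blast
  qed
  have cutw: "cut Tw \<subseteq> cl ((U' \<inter> cut Tw) \<union> Xw)"
  proof
    fix f assume f: "f \<in> cut Tw"
    then obtain n where n: "tail D f \<in> T n" unfolding cut_def Tw_def by blast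
    have hf: "head D f \<notin> Tw" using f cutD by blast
    then have "f \<in> cut (T n)" using f n unfolding cut_def Tw_def by auto
    then have "f \<in> cl ((U n \<inter> cut (T n)) \<union> X n)" using w'(11) by blast
    moreover have "indep N ((U n \<inter> cut (T n)) \<union> X n)"
      by (rule indep_subset[OF w'(10)]) auto
    \<comment> \<open>Only edges with the head of \<open>f\<close> matter. That head lies outside
      every side, so such ends are never dropped.\<close>
    moreover have "((U n \<inter> cut (T n)) \<union> X n) \<inter> {a. head D a = head D f} \<subseteq> (U' \<inter> cut Tw) \<union> Xw"
    proof
      fix a assume a: "a \<in> ((U n \<inter> cut (T n)) \<union> X n) \<inter> {a. head D a = head D f}"
      show "a \<in> (U' \<inter> cut Tw) \<union> Xw"
      proof (cases "a \<in> X n")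
        case True
        then show ?thesis unfolding Xw_def by blast
      next
        case False
        then have "a \<in> U n" "a \<in> cut (T n)" "head D a \<notin> Tw" using a hf by auto
        then have "a \<in> U'" "a \<in> cut Tw" using in_out unfolding cut_def Tw_def by auto
        then show ?thesis by blast
      qed
    qed
    ultimately show "f \<in> cl ((U' \<inter> cut Tw) \<union> Xw)" using cl_localD by blast
  qed
  have elem: "tail D u \<in> Tw \<and> head D u \<notin> S \<and> tail D u \<noteq> head D u \<and> (u \<in> L \<or> tail D u \<notin> S) \<and> u \<in> arcs D"
    if uU: "u \<in> U'" for u
  proof -
    obtain n where n: "u \<in> U n" using Ua[OF uU] by blast
    have "tail D u \<in> Tw" using w'(6)[OF n] unfolding Tw_def by blast
    then show ?thesis using w'(7)[OF n] w'(8)[OF n] w'(9)[OF n] w'(4)[of n] n by blast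
  qed
  have "S \<subseteq> Tw" "Tw \<subseteq> verts D" "t \<notin> Tw"
    using w'(1,2,3) unfolding Tw_def by auto
  then have "wave S L Xw Tw U' p'"
    unfolding wave_def using elem disj ind cutw lk by blast
  moreover have "L \<inter> cut Tw \<subseteq> U'"
  proof
    fix l assume l: "l \<in> L \<inter> cut Tw"
    then obtain n where "tail D l \<in> T n" unfolding cut_def Tw_def by blast
    then have "l \<in> cut (T n)" using l unfolding cut_def Tw_def by auto
    then have "l \<in> U n" using kept l by blast
    then show "l \<in> U'" using in_out l cutD(3) by blast
  qed
  ultimately have "kept_wave S L Xw Tw U' p'" unfolding kept_wave_def by blast
  then show ?thesis using that exw unfolding Tw_def Xw_def by blast
qed

section \<open>Maximal waves and preservation of roots\<close>

definition loose where
  "loose S L X \<longleftrightarrow> (\<forall>T U p. wave S L X T U p \<longrightarrow> T = S)"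

text \<open>Implied by looseness for a \<open>state\<close>, and the property that remains after one
  more edge joins \<open>X\<close>.\<close>

definition unhindered where
  "unhindered S L X \<longleftrightarrow> (\<forall>T U p. wave S L X T U p \<longrightarrow> L \<subseteq> U)"

text \<open>Step \<open>n\<close> covers the vertex \<open>v n\<close> if some extension of the
  current wave does. A nontrivial wave beyond the limit would compose with it to an extension of
  every stage covering a new vertex \<open>v k\<close>; but then step \<open>k\<close> had covered
  it.\<close>

lemma maximal_wave:
  assumes st: "state S L X"
  obtains T U p where "kept_wave S L X T U p" "state T (U \<inter> cut T) X" "loose T (U \<inter> cut T) X"
proof -
  define v where "v = from_nat_into (verts D)"
  define P where "P w \<longleftrightarrow> (case w of (T, U, p) \<Rightarrow> kept_wave S L X T U p)" for w
  define E where "E w w' \<longleftrightarrow> (case w of (T, U, p) \<Rightarrow> case w' of (T', U', p') \<Rightarrow> ext T U p T' U' p')" for w w'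
  have ex0: "\<exists>w. P w" using trivial_wave[OF st, of undefined] unfolding P_def by auto
  have exS: "\<exists>w'. P w' \<and> (E w w' \<and> ((\<exists>w''. P w'' \<and> E w w'' \<and> v n \<in> fst w'') \<longrightarrow> v n \<in> fst w'))"
    if "P w" for w n
  proof (cases "\<exists>w''. P w'' \<and> E w w'' \<and> v n \<in> fst w''")
    case True
    then show ?thesis by blast
  next
    case False
    have "E w w" unfolding E_def using ext_refl by (auto split: prod.split)
    then show ?thesis using False that by blast
  qed
  obtain f where f: "\<And>n. P (f n)" "\<And>n. E (f n) (f (Suc n))"
    "\<And>n. (\<exists>w''. P w'' \<and> E (f n) w'' \<and> v n \<in> fst w'') \<Longrightarrow> v n \<in> fst (f (Suc n))"
    using dependent_nat_choice[of "\<lambda>n. P" "\<lambda>n w w'. E w w' \<and> ((\<exists>w''. P w'' \<and> E w w'' \<and> v n \<in> fst w'') \<longrightarrow> v n \<in> fst w')"]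
      ex0 exS by metis
  define T where "T n = fst (f n)" for n
  define U where "U n = fst (snd (f n))" for n
  define p where "p n = snd (snd (f n))" for n
  have ff: "f n = (T n, U n, p n)" for n unfolding T_def U_def p_def by simp
  have kw: "kept_wave S L X (T n) (U n) (p n)" for n
    using f(1)[of n] unfolding P_def ff by simp
  have ex: "ext (T n) (U n) (p n) (T (Suc n)) (U (Suc n)) (p (Suc n))" for n
    using f(2)[of n] unfolding E_def ff by simp
  obtain U' p' where lim: "kept_wave S L (\<Union>n::nat. X) (\<Union>n. T n) U' p'"
    "\<And>n. ext (T n) (U n) (p n) (\<Union>n. T n) U' p'"
    by (rule wave_limit[of S L "\<lambda>_. X" T U p]) (use kw ex in auto)
  define Tw where "Tw = (\<Union>n. T n)"
  have kl: "kept_wave S L X Tw U' p'" using lim(1) unfolding Tw_def by simp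
  then have stw: "state Tw (U' \<inter> cut Tw) X" using state_of_wave[OF st] unfolding kept_wave_def by blast
  have "T2 = Tw" if w2: "wave Tw (U' \<inter> cut Tw) X T2 U2 p2" for T2 U2 p2
  proof (rule ccontr)
    assume ne: "T2 \<noteq> Tw"
    have "Tw \<subseteq> T2" "T2 \<subseteq> verts D" using waveD[OF w2] by auto
    then obtain x where x: "x \<in> T2" "x \<notin> Tw" "x \<in> verts D" using ne by blast
    then have "verts D \<noteq> {}" by blast
    then obtain k where k: "x = v k"
      using range_from_nat_into[OF _ countable_verts] x(3) unfolding v_def by blast
    obtain U3 where U3: "kept_wave Tw (U' \<inter> cut Tw) X T2 U3 p2" using keep_wave[OF stw w2] by blast
    note c = compose_waves(1,2)[OF st kl U3]
    have "ext (T k) (U k) (p k) Tw U' p'" using lim(2) unfolding Tw_def by blast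
    from ext_trans[OF this c(2)]
    have "\<exists>w''. P w'' \<and> E (f k) w'' \<and> v k \<in> fst w''"
      using c(1) x(1) k unfolding P_def E_def ff by auto
    then have "v k \<in> T (Suc k)" using f(3) unfolding T_def by blast
    then show False using x(2) k unfolding Tw_def by blast
  qed
  then have "loose Tw (U' \<inter> cut Tw) X" unfolding loose_def by blast
  then show ?thesis using that kl stw by blast
qed

text \<open>A wave with side \<open>S\<close> has all its edges in \<open>L\<close>. If it missed
  \<open>l\<close>, a part of the independent set \<open>L \<union> X\<close> without
  \<open>l\<close> would span \<open>l\<close>.\<close>

lemma loose_imp_unhindered:
  assumes st: "state S L X" and lo: "loose S L X"
  shows "unhindered S L X"
  unfolding unhindered_def
proof (intro allI impI subsetI)
  fix T U p l assume w: "wave S L X T U p" and l: "l \<in> L"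
  have TS: "T = S" using lo w unfolding loose_def by blast
  note w' = waveD[OF w, unfolded TS] and st' = stateD[OF st]
  show "l \<in> U"
  proof (rule ccontr)
    assume n: "l \<notin> U"
    have sub: "insert l (U \<inter> cut S \<union> X) \<subseteq> L \<union> X" using w'(6,9) l by auto
    have "l \<in> cl (U \<inter> cut S \<union> X)" using w'(11) l st'(3) by auto
    moreover have "l \<notin> U \<inter> cut S \<union> X" using n l st'(5) by auto
    ultimately have "\<not> indep N (insert l (U \<inter> cut S \<union> X))" unfolding cl_def by auto
    then show False using indep_subset[OF st'(6) sub] by (rule notE)
  qed
qed

text \<open>Returning \<open>e\<close> to a wave is harmless even if it is a dead end there.\<close>

lemma unhindered_delete_root:
  assumes st: "state S L X" and un: "unhindered S L X" and e: "e \<in> L"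
  shows "state S (L - {e}) (insert e X)" "unhindered S (L - {e}) (insert e X)"
proof -
  note st' = stateD[OF st]
  have eq: "L - {e} \<union> insert e X = L \<union> X" using e by auto
  show "state S (L - {e}) (insert e X)"
    unfolding state_def eq using st' e by (auto dest: cutD)
  show "unhindered S (L - {e}) (insert e X)"
    unfolding unhindered_def
  proof (intro allI impI)
    fix T U p assume w: "wave S (L - {e}) (insert e X) T U p"
    note w' = waveD[OF w] and l = linkingD[OF waveD(12)[OF w]]
    have eU: "e \<notin> U" using w'(5) by auto
    have eq2: "insert e U - L = U - (L - {e})" using e eU by auto
    have lk: "linking L (insert e U) p"
      unfolding linking_def eq2
    proof (intro conjI ballI)
      fix u assume "u \<in> U - (L - {e})"
      then show "p u \<in> insert e U" "head D (p u) = tail D u" using l(1,2) by auto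
    next
      show "inj_on p (U - (L - {e}))" by (rule l(3))
    next
      fix u assume u: "u \<in> insert e U"
      show "\<exists>F. finite F \<and> u \<in> F \<and> F \<subseteq> insert e U \<and> p ` (F - L) \<subseteq> F"
      proof (cases "u = e")
        case True
        then show ?thesis using e by (intro exI[of _ "{e}"]) auto
      next
        case False
        then obtain F where "finite F" "u \<in> F" "F \<subseteq> U" "p ` (F - (L - {e})) \<subseteq> F"
          using l(4)[of u] u by blast
        then show ?thesis using eU by (intro exI[of _ F]) auto
      qed
    qed
    have ec: "e \<in> cut S" using e st'(3) by auto
    have "cut T \<subseteq> cl ((insert e U \<inter> cut T) \<union> X)"
    proof
      fix f assume f: "f \<in> cut T"
      have "f \<in> cl ((U \<inter> cut T) \<union> insert e X)" using f w'(11) by auto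
      moreover have "indep N ((U \<inter> cut T) \<union> insert e X)"
        by (rule indep_subset[OF w'(10)]) auto
      moreover have "((U \<inter> cut T) \<union> insert e X) \<inter> {a. head D a = head D f} \<subseteq> (insert e U \<inter> cut T) \<union> X"
        using f ec w'(1) unfolding cut_def by auto
      ultimately show "f \<in> cl ((insert e U \<inter> cut T) \<union> X)" using cl_localD by blast
    qed
    moreover have "insert e U \<union> X = U \<union> insert e X" by auto
    moreover have "tail D u \<in> T \<and> head D u \<notin> S \<and> tail D u \<noteq> head D u \<and> (u \<in> L \<or> tail D u \<notin> S)"
      if "u \<in> insert e U" for u
    proof (cases "u = e")
      case True
      then show ?thesis using e ec w'(1) by (auto dest: cutD)
    next
      case False
      then show ?thesis using that w'(6)[of u] w'(7)[of u] w'(8)[of u] w'(9)[of u] by auto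
    qed
    ultimately have "wave S L X T (insert e U) p"
      unfolding wave_def using w'(1-5,10) cutD(1)[OF ec] st'(5) e lk by auto
    then have "L \<subseteq> insert e U" using un unfolding unhindered_def by blast
    then show "L - {e} \<subseteq> U" by auto
  qed
qed

definition pred_rel where "pred_rel L U p = {(u, p u) | u. u \<in> U - L}"

text \<open>Trails may stop inside \<open>T\<close>, so having all roots in \<open>U\<close> does
  not yet mean that their trails leave \<open>T\<close>.\<close>

definition full where
  "full L T U p \<longleftrightarrow> (\<forall>l\<in>L. \<exists>e\<in>U \<inter> cut T. (e, l) \<in> (pred_rel L U p)\<^sup>*)"

text \<open>Discarding the trails that do not leave \<open>T\<close> yields a wave with the same
  ends. It must still contain every root, so each root lies on a trail that was kept.\<close>

lemma unhindered_full:
  assumes un: "unhindered S L X" and w: "wave S L X T U p"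
  shows "full L T U p"
proof -
  note w' = waveD[OF w] and l = linkingD[OF waveD(12)[OF w]]
  define U' where "U' = {u \<in> U. \<exists>e\<in>U \<inter> cut T. (e, u) \<in> (pred_rel L U p)\<^sup>*}"
  have sub: "U' \<subseteq> U" unfolding U'_def by auto
  have ends: "U' \<inter> cut T = U \<inter> cut T" unfolding U'_def by auto
  have "linking L U' p"
  proof (rule linking_restrict[OF w'(12) sub])
    fix u assume u: "u \<in> U'" "u \<notin> L"
    then have "(u, p u) \<in> pred_rel L U p" using sub unfolding pred_rel_def by auto
    moreover obtain e where "e \<in> U \<inter> cut T" "(e, u) \<in> (pred_rel L U p)\<^sup>*" using u unfolding U'_def by blast
    ultimately have "(e, p u) \<in> (pred_rel L U p)\<^sup>*" by (meson rtrancl.rtrancl_into_rtrancl)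
    then show "p u \<in> U'" using l(1) u sub \<open>e \<in> U \<inter> cut T\<close> unfolding U'_def by blast
  qed
  moreover have "indep N (U' \<union> X)" by (rule indep_subset[OF w'(10)]) (use sub in auto)
  ultimately have "wave S L X T U' p"
    unfolding wave_def ends using w'(1-5,11) w'(6-9)[OF subsetD[OF sub]] sub by auto
  then have "L \<subseteq> U'" using un unfolding unhindered_def by blast
  then show ?thesis unfolding full_def U'_def by blast
qed

text \<open>A root is followed to an end of the first wave, which \<open>un\<close> forces into the
  second wave and on to its cut. The edges added beyond this end lie outside \<open>U\<close> and
  \<open>L\<close>, so both chains remain chains of the combined predecessor map.\<close>

lemma compose_full:
  assumes st: "state S L X" and w1: "kept_wave S L X T U p"
    and w2: "kept_wave T (U \<inter> cut T) X T' U' p'"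
    and f1: "full L T U p" and un: "unhindered T (U \<inter> cut T) X"
  shows "full L T' ({u \<in> U. head D u \<in> T} \<union> U') (\<lambda>u. if u \<in> U then p u else p' u)"
    (is "full L T' ?U ?p")
proof -
  have k1: "wave S L X T U p" "L \<inter> cut T \<subseteq> U" using w1 unfolding kept_wave_def by auto
  have k2: "wave T (U \<inter> cut T) X T' U' p'" using w2 unfolding kept_wave_def by auto
  have f2: "full (U \<inter> cut T) T' U' p'" by (rule unhindered_full[OF un k2])
  have LU: "U \<inter> cut T \<subseteq> U'" using un k2 unfolding unhindered_def by blast
  note st' = stateD[OF st] and w1' = waveD[OF k1(1)] and w2' = waveD[OF k2]
  note l1 = linkingD[OF w1'(12)]
  show ?thesis
    unfolding full_def
  proof
    fix l assume "l \<in> L"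
    then obtain e1 where e1: "e1 \<in> U \<inter> cut T" "(e1, l) \<in> (pred_rel L U p)\<^sup>*" using f1 unfolding full_def by blast
    then obtain e2 where e2: "e2 \<in> U' \<inter> cut T'" "(e2, e1) \<in> (pred_rel (U \<inter> cut T) U' p')\<^sup>*"
      using f2 unfolding full_def by blast
    have "pred_rel (U \<inter> cut T) U' p' \<subseteq> pred_rel L ?U ?p"
    proof
      fix z assume "z \<in> pred_rel (U \<inter> cut T) U' p'"
      then obtain u where u: "z = (u, p' u)" "u \<in> U'" "u \<notin> U \<inter> cut T" unfolding pred_rel_def by blast
      have nT: "head D u \<notin> T" using w2'(7) u by blast
      have nU: "u \<notin> U" using u nT w1'(4,6) unfolding cut_def by auto
      have "u \<notin> L"
      proof
        assume "u \<in> L"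
        then have "u \<in> cut T" using st'(3) w1'(1) nT unfolding cut_def by auto
        then show False using nU \<open>u \<in> L\<close> k1(2) by auto
      qed
      then show "z \<in> pred_rel L ?U ?p" using u nU unfolding pred_rel_def by auto
    qed
    then have 2: "(e2, e1) \<in> (pred_rel L ?U ?p)\<^sup>*" using e2(2) rtrancl_mono by blast
    have "x \<in> U \<and> x \<in> ?U \<and> (e1, x) \<in> (pred_rel L ?U ?p)\<^sup>*" if "(e1, x) \<in> (pred_rel L U p)\<^sup>*" for x
      using that
    proof (induction rule: rtrancl_induct)
      case base
      show ?case using e1(1) LU by auto
    next
      case (step y z)
      then have y: "y \<in> U" "y \<notin> L" "z = p y" unfolding pred_rel_def by auto
      then have z: "z \<in> U" "head D z \<in> T" using l1(1,2) w1'(6) by auto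
      have "(y, z) \<in> pred_rel L ?U ?p" using y step.IH unfolding pred_rel_def by auto
      then have "(e1, z) \<in> (pred_rel L ?U ?p)\<^sup>*" using step.IH by (meson rtrancl.rtrancl_into_rtrancl)
      then show ?case using z by blast
    qed
    then have "(e1, l) \<in> (pred_rel L ?U ?p)\<^sup>*" using e1(2) by blast
    then have "(e2, l) \<in> (pred_rel L ?U ?p)\<^sup>*" using 2 by (meson rtrancl_trans)
    then show "\<exists>e\<in>?U \<inter> cut T'. (e, l) \<in> (pred_rel L ?U ?p)\<^sup>*" using e2(1) by blast
  qed
qed

end

section \<open>Augmenting\<close>

lemma (in matroid) cl_exchange:
  assumes B: "indep M B" "g \<in> B" and f: "f \<in> cl B" and n: "f \<notin> B" and B': "indep M (insert f (B - {g}))"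
  shows "cl (insert f (B - {g})) = cl B"
proof -
  let ?B = "insert f (B - {g})"
  have gr: "B \<subseteq> ground M" "f \<in> ground M" using indep_subset_ground[OF B(1)] f by (auto simp: cl_def)
  have "?B \<subseteq> cl B" using subset_cl[OF gr(1)] f by auto
  moreover have "B \<subseteq> cl ?B"
  proof
    fix x assume x: "x \<in> B"
    show "x \<in> cl ?B"
    proof (cases "x = g")
      case False
      then show ?thesis using x gr(1) by (auto simp: cl_def)
    next
      case True
      show ?thesis
      proof (cases "f = g")
        case True
        then show ?thesis using \<open>x = g\<close> gr(2) by (simp add: cl_def)
      next
        case False
        then have "\<not> indep M (insert f B)" using f n by (auto simp: cl_def)
        moreover have "insert x ?B = insert f B" using x \<open>x = g\<close> by auto
        ultimately show ?thesis using x gr(1) by (auto simp: cl_def)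
      qed
    qed
  qed
  ultimately show ?thesis using cl_trans[OF B(1) B'] cl_trans[OF B' B(1)] by auto
qed

context matroid_network
begin

section \<open>Local changes of a linking\<close>

lemma linkingI:
  assumes "\<And>u. u \<in> U \<Longrightarrow> u \<notin> L \<Longrightarrow> p u \<in> U \<and> head D (p u) = tail D u"
    and "\<And>u v. u \<in> U \<Longrightarrow> u \<notin> L \<Longrightarrow> v \<in> U \<Longrightarrow> v \<notin> L \<Longrightarrow> p u = p v \<Longrightarrow> u = v"
    and "\<And>u. u \<in> U \<Longrightarrow> \<exists>F. finite F \<and> u \<in> F \<and> F \<subseteq> U \<and> p ` (F - L) \<subseteq> F"
  shows "linking L U p"
  unfolding linking_def inj_on_def using assms by blast

lemma linking_push:
  assumes l: "linking L U p" and f: "f \<notin> U"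
    and y: "f \<notin> L \<Longrightarrow> y \<in> U \<and> head D y = tail D f \<and> (\<forall>u\<in>U - L. p u \<noteq> y)"
  shows "linking L (insert f U) (p(f := y))" (is "linking L ?U ?p")
    and "\<And>u. u \<in> insert f U \<Longrightarrow> u \<notin> L \<Longrightarrow> (p(f := y)) u \<noteq> f"
proof -
  note l' = linkingD[OF l]
  show "linking L ?U ?p"
  proof (rule linkingI)
    fix u assume "u \<in> ?U" "u \<notin> L"
    then show "?p u \<in> ?U \<and> head D (?p u) = tail D u" using l'(1,2)[of u] y by auto
  next
    fix u v assume "u \<in> ?U" "u \<notin> L" "v \<in> ?U" "v \<notin> L" "?p u = ?p v"
    then show "u = v" using inj_onD[OF l'(3), of u v] y by (auto split: if_splits)
  next
    fix u assume u: "u \<in> ?U"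
    show "\<exists>F. finite F \<and> u \<in> F \<and> F \<subseteq> ?U \<and> ?p ` (F - L) \<subseteq> F"
    proof (cases "u = f")
      case False
      then obtain F where "finite F" "u \<in> F" "F \<subseteq> U" "p ` (F - L) \<subseteq> F" using l'(4)[of u] u by blast
      then show ?thesis using f by (intro exI[of _ F]) auto
    next
      case uf: True
      show ?thesis
      proof (cases "f \<in> L")
        case True
        then show ?thesis using uf by (intro exI[of _ "{f}"]) auto
      next
        case False
        then obtain F where "finite F" "y \<in> F" "F \<subseteq> U" "p ` (F - L) \<subseteq> F" using l'(4)[of y] y by blast
        then show ?thesis using f uf by (intro exI[of _ "insert f F"]) auto
      qed
    qed
  qed
  fix u assume "u \<in> insert f U" "u \<notin> L"
  then show "(p(f := y)) u \<noteq> f" using l'(1)[of u] y f by auto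
qed

text \<open>\<open>f\<close> takes the place of \<open>g\<close> at their common head, so what
  followed \<open>g\<close> now follows \<open>f\<close>. The edge before \<open>g\<close> loses its
  successor and becomes the free end from which the search continues.\<close>

lemma linking_swap:
  assumes l: "linking L U p" and f: "f \<notin> U" and g: "g \<in> U" "head D f = head D g" "tail D g \<noteq> head D g"
    and y: "f \<notin> L \<Longrightarrow> y \<in> U \<and> y \<noteq> g \<and> head D y = tail D f \<and> (\<forall>u\<in>U - L. p u \<noteq> y)"
  defines "U' \<equiv> insert f (U - {g})"
    and "p' \<equiv> (\<lambda>u. if u = f then y else if p u = g then f else p u)"
  shows "linking L U' p'"
    and "g \<notin> L \<Longrightarrow> p g \<in> U' \<and> (\<forall>u\<in>U' - L. p' u \<noteq> p g)"
proof -
  note l' = linkingD[OF l]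
  have gf: "g \<noteq> f" using f g(1) by auto
  have pf: "p u \<noteq> f" if "u \<in> U" "u \<notin> L" for u using l'(1)[OF that] f by auto
  have U': "u \<in> U" "u \<noteq> g" if "u \<in> U'" "u \<noteq> f" for u using that unfolding U'_def by auto
  show "linking L U' p'"
  proof (rule linkingI)
    fix u assume u: "u \<in> U'" "u \<notin> L"
    show "p' u \<in> U' \<and> head D (p' u) = tail D u"
    proof (cases "u = f")
      case True
      then show ?thesis using y u unfolding p'_def U'_def by auto
    next
      case False
      then have uU: "u \<in> U" using U' u by blast
      show ?thesis
      proof (cases "p u = g")
        case True
        then have "p' u = f" using False unfolding p'_def by simp
        then show ?thesis using l'(2)[OF uU u(2)] True g(2) unfolding U'_def by simp
      next
        case ng: False
        then have "p' u = p u" using False unfolding p'_def by simp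
        then show ?thesis using l'(1,2)[OF uU u(2)] ng unfolding U'_def by simp
      qed
    qed
  next
    fix u v assume uv: "u \<in> U'" "u \<notin> L" "v \<in> U'" "v \<notin> L" "p' u = p' v"
    have A: "p' w \<noteq> y" if "w \<in> U'" "w \<notin> L" "w \<noteq> f" "f \<notin> L" for w
      using that y U'[of w] f unfolding p'_def by auto
    show "u = v"
    proof (cases "u = f \<or> v = f")
      case True
      then show ?thesis using A uv unfolding p'_def by metis
    next
      case False
      then have "p u = p v" using uv pf[of u] pf[of v] U'[of u] U'[of v] unfolding p'_def by (auto split: if_splits)
      then show ?thesis using inj_onD[OF l'(3), of u v] uv U'[of u] U'[of v] False by auto
    qed
  next
    fix u assume u: "u \<in> U'"
    have ex: "\<exists>F. finite F \<and> w \<in> F \<and> F \<subseteq> U \<and> p ` (F - L) \<subseteq> F" if "w \<in> U" for w using l'(4)[OF that] .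
    obtain Fu where Fu: "finite Fu" "u \<noteq> f \<Longrightarrow> u \<in> Fu" "Fu \<subseteq> U" "p ` (Fu - L) \<subseteq> Fu"
    proof (cases "u = f")
      case True
      then show ?thesis using that[of "{}"] by auto
    next
      case False
      then show ?thesis using ex[of u] U'[OF u] that by blast
    qed
    obtain Fy where Fy: "finite Fy" "f \<notin> L \<Longrightarrow> y \<in> Fy" "Fy \<subseteq> U" "p ` (Fy - L) \<subseteq> Fy"
    proof (cases "f \<in> L")
      case True
      then show ?thesis using that[of "{}"] by auto
    next
      case False
      then show ?thesis using ex[of y] y that by blast
    qed
    \<comment> \<open>A backward trail through \<open>g\<close> is diverted to \<open>f\<close> and
      then to \<open>y\<close>, so a closed set for \<open>y\<close> is added.\<close>
    let ?F = "insert f (Fu \<union> Fy) - {g}"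
    have "p' ` (?F - L) \<subseteq> ?F"
    proof
      fix z assume "z \<in> p' ` (?F - L)"
      then obtain v where v: "v \<in> ?F" "v \<notin> L" "z = p' v" by auto
      show "z \<in> ?F"
      proof (cases "v = f")
        case True
        then show ?thesis using v y Fy(2) unfolding p'_def by auto
      next
        case False
        then have "p v \<in> Fu \<union> Fy" using v Fu(4) Fy(4) by auto
        then show ?thesis using v(3) False gf unfolding p'_def by auto
      qed
    qed
    moreover have "u \<in> ?F" using Fu(2) u gf unfolding U'_def by auto
    moreover have "?F \<subseteq> U'" using Fu(3) Fy(3) unfolding U'_def by auto
    ultimately show "\<exists>F. finite F \<and> u \<in> F \<and> F \<subseteq> U' \<and> p' ` (F - L) \<subseteq> F"
      using Fu(1) Fy(1) by (intro exI[of _ ?F]) auto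
  qed
  assume gL: "g \<notin> L"
  have pg: "p g \<in> U" "head D (p g) = tail D g" using l'(1,2)[OF g(1) gL] by auto
  have "p g \<noteq> g" using pg(2) g(3) by auto
  moreover have "p' u \<noteq> p g" if u: "u \<in> U'" "u \<notin> L" for u
  proof (cases "u = f")
    case True
    then show ?thesis using y u g(1) gL unfolding p'_def by auto
  next
    case False
    have "p u \<noteq> p g" using inj_onD[OF l'(3), of u g] U'[OF u(1) False] u(2) g(1) gL by auto
    then show ?thesis using False pf[OF g(1) gL] unfolding p'_def by auto
  qed
  ultimately show "p g \<in> U' \<and> (\<forall>u\<in>U' - L. p' u \<noteq> p g)" using pg(1) unfolding U'_def by auto
qed

text \<open>The trail ending in \<open>y\<close> is spliced to what followed \<open>g\<close>, as
  both edges enter the same vertex. The initial part of the trail through \<open>g\<close> is left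
  with the free end \<open>p g\<close>.\<close>

lemma linking_pull:
  assumes l: "linking L U p" and y: "y \<in> U" "\<And>u. u \<in> U \<Longrightarrow> u \<notin> L \<Longrightarrow> p u \<noteq> y"
    and g: "g \<in> U" "head D g = head D y" "tail D g \<noteq> head D g"
  defines "p' \<equiv> (\<lambda>u. if p u = g then y else p u)"
  shows "linking L (U - {g}) p'"
    and "g \<notin> L \<Longrightarrow> p g \<in> U - {g} \<and> (\<forall>u\<in>U - {g} - L. p' u \<noteq> p g)"
proof -
  note l' = linkingD[OF l]
  have yg: "y \<noteq> g" if "u \<in> U" "u \<notin> L" "p u = g" for u using y(2)[OF that(1,2)] that(3) by auto
  show "linking L (U - {g}) p'"
  proof (rule linkingI)
    fix u assume u: "u \<in> U - {g}" "u \<notin> L"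
    then show "p' u \<in> U - {g} \<and> head D (p' u) = tail D u"
      using l'(1,2)[of u] yg[of u] y(1) g(2) unfolding p'_def by auto
  next
    fix u v assume uv: "u \<in> U - {g}" "u \<notin> L" "v \<in> U - {g}" "v \<notin> L" "p' u = p' v"
    then have "p u = p v" using y(2)[of u] y(2)[of v] unfolding p'_def by (auto split: if_splits)
    then show "u = v" using inj_onD[OF l'(3), of u v] uv by auto
  next
    fix u assume u: "u \<in> U - {g}"
    obtain Fu where Fu: "finite Fu" "u \<in> Fu" "Fu \<subseteq> U" "p ` (Fu - L) \<subseteq> Fu" using l'(4)[of u] u by blast
    obtain Fy where Fy: "finite Fy" "y \<in> Fy" "Fy \<subseteq> U" "p ` (Fy - L) \<subseteq> Fy" using l'(4)[OF y(1)] by blast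
    let ?F = "Fu \<union> Fy - {g}"
    have "p' ` (?F - L) \<subseteq> ?F"
    proof
      fix z assume "z \<in> p' ` (?F - L)"
      then obtain v where v: "v \<in> ?F" "v \<notin> L" "z = p' v" by auto
      have "v \<in> U" using v(1) Fu(3) Fy(3) by auto
      have "p v \<in> Fu \<union> Fy" using v Fu(4) Fy(4) by auto
      then show "z \<in> ?F" using v(3) Fy(2) yg[OF \<open>v \<in> U\<close> v(2)] unfolding p'_def by auto
    qed
    then show "\<exists>F. finite F \<and> u \<in> F \<and> F \<subseteq> U - {g} \<and> p' ` (F - L) \<subseteq> F"
      using Fu(1-3) Fy(1,3) u by (intro exI[of _ ?F]) auto
  qed
  assume gL: "g \<notin> L"
  have pg: "p g \<in> U" "head D (p g) = tail D g" using l'(1,2)[OF g(1) gL] by auto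
  have "p g \<noteq> g" using pg(2) g(3) by auto
  moreover have "p' u \<noteq> p g" if u: "u \<in> U - {g}" "u \<notin> L" for u
  proof -
    have "p u \<noteq> p g" using inj_onD[OF l'(3), of u g] u g(1) gL by auto
    then show ?thesis using y(2)[OF g(1) gL] unfolding p'_def by auto
  qed
  ultimately show "p g \<in> U - {g} \<and> (\<forall>u\<in>U - {g} - L. p' u \<noteq> p g)" using pg(1) by auto
qed

end

text \<open>
  If adding \<open>x\<close> to \<open>X\<close> creates a wave that misses a root \<open>b\<close>, send a token from the source along
  augmenting moves: it advances along an edge that keeps independence (push), advances along an edge
  exchanged against a member of its fundamental circuit (swap), or withdraws an edge
  entering the same vertex (pull); after the last two it stands at the tail of the removed edge.
  Recording all reachable configurations avoids choosing a shortest augmenting path.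
\<close>

locale augmentation = matroid_network D N t
  for D :: "('v, 'e) pre_digraph" and N :: "'e matroid_data" and t :: 'v +
  fixes S T :: "'v set" and L X U0 :: "'e set" and p0 :: "'e \<Rightarrow> 'e" and x b :: 'e
  assumes st: "state S L X" and lo: "loose S L X"
    and xi: "x \<notin> L" "indep N (insert x (L \<union> X))"
    and w0: "wave S L (insert x X) T U0 p0"
    and b: "b \<in> L" "b \<notin> U0"
begin

text \<open>\<open>None\<close> is the contracted source, left only by edges of \<open>L\<close>;
  \<open>Some y\<close> places the token at the head of \<open>y\<close>.\<close>

fun source :: "'e option \<Rightarrow> 'e \<Rightarrow> bool" where
  "source None f \<longleftrightarrow> f \<in> L"
| "source (Some y) f \<longleftrightarrow> head D y \<in> T \<and> tail D f = head D y"

definition pushable :: "'e set \<Rightarrow> 'e option \<Rightarrow> 'e \<Rightarrow> bool" where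
  "pushable U z f \<longleftrightarrow> f \<in> arcs D \<and> f \<notin> X \<and> f \<notin> U \<and> head D f \<notin> S \<and> tail D f \<noteq> head D f \<and> source z f"

definition prev :: "('e \<Rightarrow> 'e) \<Rightarrow> 'e \<Rightarrow> 'e option" where
  "prev p g = (if g \<in> L then None else Some (p g))"

text \<open>When \<open>z\<close> is \<open>None\<close>, the new edge \<open>f\<close> is a root,
  so the junk value \<open>the None\<close> does not matter: predecessors of roots are
  ignored.\<close>

inductive reach :: "'e set \<Rightarrow> ('e \<Rightarrow> 'e) \<Rightarrow> 'e option \<Rightarrow> bool" where
  init: "reach U0 p0 None"
| push: "reach U p z \<Longrightarrow> pushable U z f \<Longrightarrow> indep N (insert f U \<union> X) \<Longrightarrow>
    reach (insert f U) (p(f := the z)) (Some f)"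
| swap: "reach U p z \<Longrightarrow> pushable U z f \<Longrightarrow> \<not> indep N (insert f (U \<union> X)) \<Longrightarrow> g \<in> U \<Longrightarrow>
    indep N (insert f (U - {g} \<union> X)) \<Longrightarrow>
    reach (insert f (U - {g})) (\<lambda>u. if u = f then the z else if p u = g then f else p u) (prev p g)"
| pull: "reach U p (Some y) \<Longrightarrow> head D y \<in> T \<Longrightarrow> g \<in> U \<Longrightarrow> head D g = head D y \<Longrightarrow>
    reach (U - {g}) (\<lambda>u. if p u = g then y else p u) (prev p g)"

text \<open>The token stands on a free end, so attaching an edge there keeps predecessors
  injective.\<close>

definition good_token where
  "good_token U p z \<longleftrightarrow> (\<forall>y. z = Some y \<longrightarrow> y \<in> U \<and> (\<forall>u\<in>U - L. p u \<noteq> y))"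

definition good where
  "good U \<longleftrightarrow> U \<subseteq> arcs D \<and> U \<inter> X = {} \<and> indep N (U \<union> X) \<and>
    (\<forall>u\<in>U. tail D u \<in> T \<and> head D u \<notin> S \<and> tail D u \<noteq> head D u \<and> (u \<in> L \<or> tail D u \<notin> S))"

lemma goodD:
  assumes "good U"
  shows "U \<subseteq> arcs D" "U \<inter> X = {}" "indep N (U \<union> X)" "\<And>u. u \<in> U \<Longrightarrow> tail D u \<in> T"
    "\<And>u. u \<in> U \<Longrightarrow> head D u \<notin> S" "\<And>u. u \<in> U \<Longrightarrow> tail D u \<noteq> head D u"
    "\<And>u. u \<in> U \<Longrightarrow> u \<in> L \<or> tail D u \<notin> S"
  using assms unfolding good_def by auto

lemmas st' = stateD[OF st] and w0' = waveD[OF w0]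

lemma pushableD:
  assumes "pushable U z f"
  shows "f \<in> arcs D" "f \<notin> X" "f \<notin> U" "head D f \<notin> S" "tail D f \<noteq> head D f" "source z f"
  using assms unfolding pushable_def by auto

lemma source_tail: "source z f \<Longrightarrow> tail D f \<in> T"
  using st'(3) w0'(1) by (cases z) (auto dest: cutD)

lemma good_insert:
  assumes g: "good U" and "\<And>y. z = Some y \<Longrightarrow> y \<in> U" and f: "pushable U z f" and "indep N (insert f U \<union> X)"
  shows "good (insert f U)"
proof -
  have "f \<in> L \<or> tail D f \<notin> S"
    using pushableD(6)[OF f] assms(2) goodD(5)[OF g] by (cases z) auto
  then show ?thesis
    using assms pushableD[OF f] source_tail[OF pushableD(6)[OF f]] unfolding good_def by auto
qed

lemma good_mono: "good U \<Longrightarrow> U' \<subseteq> U \<Longrightarrow> good U'"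
proof -
  assume g: "good U" and s: "U' \<subseteq> U"
  have "indep N (U' \<union> X)" by (rule indep_subset[OF goodD(3)[OF g]]) (use s in auto)
  then show "good U'" using g s unfolding good_def by blast
qed

text \<open>If the heads differed, removing \<open>g\<close> would leave the edges at the head of
  \<open>f\<close> untouched and could not cure a dependence caused by \<open>f\<close>.\<close>

lemma swap_same_head:
  assumes g: "good U" and f: "f \<in> arcs D" and dep: "\<not> indep N (insert f (U \<union> X))"
    and i: "indep N (insert f (U - {g} \<union> X))"
  shows "head D g = head D f"
proof (rule ccontr)
  assume ne: "head D g \<noteq> head D f"
  have "indep N (insert f (U \<union> X))"
  proof (rule indep_localI)
    show "insert f (U \<union> X) \<subseteq> arcs D" using goodD(1)[OF g] f st'(4) by auto
    fix v
    show "\<exists>K. indep N K \<and> insert f (U \<union> X) \<inter> {a. head D a = v} \<subseteq> K"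
    proof (cases "v = head D f")
      case True
      then show ?thesis using i ne by (intro exI[of _ "insert f (U - {g} \<union> X)"]) auto
    next
      case False
      then show ?thesis using goodD(3)[OF g] by (intro exI[of _ "U \<union> X"]) auto
    qed
  qed
  then show False using dep by simp
qed

lemma reach_good: "reach U p z \<Longrightarrow> good U \<and> linking L U p \<and> good_token U p z"
proof (induction rule: reach.induct)
  case init
  have "indep N (U0 \<union> X)" by (rule indep_subset[OF w0'(10)]) auto
  then show ?case
    using w0'(4-9) w0'(12) unfolding good_def good_token_def by auto
next
  case (push U p z f)
  then have g: "good U" and l: "linking L U p" and tok: "good_token U p z" by auto
  note f = pushableD[OF push.hyps(2)]
  have y: "the z \<in> U \<and> head D (the z) = tail D f \<and> (\<forall>u\<in>U - L. p u \<noteq> the z)" if "f \<notin> L"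
    using tok f(6) that unfolding good_token_def by (cases z) auto
  have "good (insert f U)"
    by (rule good_insert[OF g _ push.hyps(2,3)]) (use tok in \<open>auto simp: good_token_def\<close>)
  moreover have "good_token (insert f U) (p(f := the z)) (Some f)"
    using linking_push(2)[OF l f(3) y] unfolding good_token_def by simp
  ultimately show ?case using linking_push(1)[OF l f(3) y] by (intro conjI)
next
  case (swap U p z f g)
  then have gU: "good U" and l: "linking L U p" and tok: "good_token U p z" by auto
  note f = pushableD[OF swap.hyps(2)]
  have hd: "head D g = head D f" using swap_same_head[OF gU f(1) swap.hyps(3,5)] .
  have y: "the z \<in> U \<and> the z \<noteq> g \<and> head D (the z) = tail D f \<and> (\<forall>u\<in>U - L. p u \<noteq> the z)" if "f \<notin> L"
    using tok f(5,6) that hd unfolding good_token_def by (cases z) auto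
  have g1: "good (U - {g})" using good_mono[OF gU] by auto
  have L': "f \<in> L \<or> tail D f \<notin> S"
    using f(6) tok goodD(5)[OF gU] by (cases z) (auto simp: good_token_def)
  have "good (insert f (U - {g}))"
    using g1 f source_tail[OF f(6)] L' swap.hyps(5) unfolding good_def by auto
  moreover note linking_swap[OF l f(3) swap.hyps(4) hd[symmetric] goodD(6)[OF gU swap.hyps(4)] y]
  ultimately show ?case unfolding good_token_def prev_def by (cases "g \<in> L") simp_all
next
  case (pull U p y g)
  then have gU: "good U" and l: "linking L U p" and tok: "good_token U p (Some y)" by auto
  have y: "y \<in> U" "\<And>u. u \<in> U \<Longrightarrow> u \<notin> L \<Longrightarrow> p u \<noteq> y" using tok unfolding good_token_def by auto
  have "good (U - {g})" using good_mono[OF gU] by auto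
  moreover note linking_pull[OF l y pull.hyps(3,4) goodD(6)[OF gU pull.hyps(3)]]
  ultimately show ?case unfolding good_token_def prev_def by (cases "g \<in> L") simp_all
qed

section \<open>The vertices visited by the token\<close>

definition reached where
  "reached = S \<union> {head D y | y U p. reach U p (Some y)}"

lemma reachedI: "reach U p (Some y) \<Longrightarrow> head D y \<in> reached"
  unfolding reached_def by blast

lemma prev_reached:
  assumes r: "reach U' p' (prev p g)" and l: "linking L U p" and g: "g \<in> U"
  shows "tail D g \<in> reached"
proof (cases "g \<in> L")
  case True
  then show ?thesis using st'(3) unfolding reached_def by (auto dest: cutD)
next
  case False
  then have "head D (p g) = tail D g" using linkingD(2)[OF l g] by auto
  then show ?thesis using reachedI[of U' p' "p g"] r False unfolding prev_def by simp
qed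

lemma source_reached: "reach U p z \<Longrightarrow> source z f \<Longrightarrow> tail D f \<in> reached"
  using reachedI st'(3) by (cases z) (auto simp: reached_def dest: cutD)

text \<open>
  At vertices the token never visits, exchanges happen only among edges with reached tail, so
  these edges keep their span in all configurations.
\<close>

definition inner where
  "inner U = {u \<in> U. tail D u \<in> reached \<and> head D u \<notin> reached} \<union> X"

lemma indep_inner: "good U \<Longrightarrow> indep N (inner U)"
  by (rule indep_subset[OF goodD(3)]) (auto simp: inner_def)

text \<open>Every \<open>g\<close> outside \<open>X\<close> in the fundamental circuit of
  \<open>f\<close> admits a swap, after which the token is at the tail of \<open>g\<close>. So these
  tails are reached, their heads equal the unreached head of \<open>f\<close>, and the circuit lies
  in \<open>insert f (inner U)\<close>.\<close>

lemma swap_cl_inner: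
  assumes r: "reach U p z" and f: "pushable U z f" and dep: "\<not> indep N (insert f (U \<union> X))"
    and hf: "head D f \<notin> reached"
  shows "f \<in> cl (inner U)"
proof -
  have gU: "good U" and l: "linking L U p" using reach_good[OF r] by auto
  note f' = pushableD[OF f]
  have fg: "f \<in> ground N" using f'(1) ground_N by simp
  obtain C where C: "C \<subseteq> U \<union> X" "\<not> indep N (insert f C)"
    "\<And>g. g \<in> C \<Longrightarrow> indep N (insert f (U \<union> X - {g}))"
    using fundamental_circuit[OF goodD(3)[OF gU] fg dep] by blast
  have "C \<subseteq> inner U"
  proof
    fix g assume g: "g \<in> C"
    show "g \<in> inner U"
    proof (cases "g \<in> X")
      case True
      then show ?thesis unfolding inner_def by simp
    next
      case False
      then have gU': "g \<in> U" using C(1) g by auto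
      have "U \<union> X - {g} = U - {g} \<union> X" using False by auto
      then have i: "indep N (insert f (U - {g} \<union> X))" using C(3)[OF g] by simp
      have "tail D g \<in> reached"
        by (rule prev_reached[OF reach.swap[OF r f dep gU' i] l gU'])
      moreover have "head D g \<notin> reached" using swap_same_head[OF gU f'(1) dep i] hf by simp
      ultimately show ?thesis using gU' unfolding inner_def by simp
    qed
  qed
  then have "\<not> indep N (insert f (inner U))" using indep_subset C(2) insert_mono by metis
  then show ?thesis using fg unfolding cl_def by simp
qed

lemma cl_inner:
  "reach U p z \<Longrightarrow> cl (inner U) = cl (inner U0)"
proof (induction rule: reach.induct)
  case init
  show ?case by simp
next
  case (push U p z f)
  have "head D f \<in> reached" using reachedI[OF reach.push[OF push.hyps]] .
  then have "inner (insert f U) = inner U" unfolding inner_def by auto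
  then show ?case using push.IH by simp
next
  case (swap U p z f g)
  have gU: "good U" using reach_good swap.hyps(1) by blast
  note f = pushableD[OF swap.hyps(2)]
  have hd: "head D g = head D f" using swap_same_head[OF gU f(1) swap.hyps(3,5)] .
  show ?case
  proof (cases "head D f \<in> reached")
    case True
    then have "inner (insert f (U - {g})) = inner U" using hd unfolding inner_def by auto
    then show ?thesis using swap.IH by simp
  next
    case False
    have fcl: "f \<in> cl (inner U)" by (rule swap_cl_inner[OF swap.hyps(1,2,3) False])
    have l: "linking L U p" using reach_good swap.hyps(1) by blast
    have tg: "tail D g \<in> reached"
      by (rule prev_reached[OF reach.swap[OF swap.hyps(1-5)] l swap.hyps(4)])
    have tf: "tail D f \<in> reached" by (rule source_reached[OF swap.hyps(1) f(6)])
    have gX: "g \<notin> X" using goodD(2)[OF gU] swap.hyps(4) by auto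
    have gi: "g \<in> inner U" using tg swap.hyps(4) hd False unfolding inner_def by auto
    have eq: "inner (insert f (U - {g})) = insert f (inner U - {g})"
      using tf False gX unfolding inner_def by auto
    have "good (insert f (U - {g}))"
      using reach_good[OF reach.swap[OF swap.hyps(1-5)]] by blast
    then have "indep N (insert f (inner U - {g}))" using indep_inner[of "insert f (U - {g})"] eq by simp
    moreover have "f \<notin> inner U" using f(2,3) unfolding inner_def by auto
    ultimately have "cl (insert f (inner U - {g})) = cl (inner U)"
      using cl_exchange[OF indep_inner[OF gU] gi fcl] by blast
    then show ?thesis using eq swap.IH by simp
  qed
next
  case (pull U p y g)
  have "head D y \<in> reached" using reachedI[OF pull.hyps(1)] .
  then have "inner (U - {g}) = inner U" using pull.hyps(4) unfolding inner_def by auto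
  then show ?case using pull.IH by simp
qed

text \<open>An independent push would make the head reached. So \<open>f\<close> is either present
  already or dependent, and in both cases spanned by \<open>inner U\<close>, whose span never
  changes.\<close>

lemma arc_out_of_reached:
  assumes r: "reach U p z" and f: "f \<in> arcs D" "source z f" "head D f \<notin> reached"
  shows "f \<in> cl (inner U0)"
proof -
  have gU: "good U" using reach_good[OF r] by blast
  have tf: "tail D f \<in> reached" by (rule source_reached[OF r f(2)])
  have "f \<in> cl (inner U)"
  proof (cases "f \<in> U \<union> X")
    case True
    then have "f \<in> inner U" using tf f(3) unfolding inner_def by auto
    then show ?thesis using subset_cl[OF indep_subset_ground[OF indep_inner[OF gU]]] by auto
  next
    case False
    have pf: "pushable U z f"
      using False f tf unfolding pushable_def reached_def by auto
    have "\<not> indep N (insert f U \<union> X)"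
      using reachedI[OF reach.push[OF r pf]] f(3) by blast
    then have "\<not> indep N (insert f (U \<union> X))" by simp
    then show ?thesis using swap_cl_inner[OF r pf] f(3) by blast
  qed
  then show ?thesis using cl_inner[OF r] by simp
qed

lemma removed_reached: "reach U p z \<Longrightarrow> g \<in> U0 \<Longrightarrow> g \<notin> U \<Longrightarrow> tail D g \<in> reached"
proof (induction arbitrary: g rule: reach.induct)
  case (swap U p z f h)
  then show ?case
    using prev_reached[OF reach.swap[OF swap.hyps(1-5)]] reach_good[OF swap.hyps(1)] by auto
next
  case (pull U p y h)
  then show ?case
    using prev_reached[OF reach.pull[OF pull.hyps(1-4)]] reach_good[OF pull.hyps(1)] by auto
qed auto

definition outer where "outer U = {u \<in> U. head D u \<notin> T} \<union> X"

lemma outer_eq: "good U \<Longrightarrow> U \<inter> cut T \<union> X = outer U"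
  using goodD(1,4) unfolding outer_def cut_def by blast

lemma indep_outer: "good U \<Longrightarrow> indep N (outer U)"
  by (rule indep_subset[OF goodD(3)]) (auto simp: outer_def)

lemma cut_T_cl: "cut T \<subseteq> cl (insert x (outer U0))" "indep N (insert x (outer U0))"
proof -
  have "U0 \<inter> cut T \<union> insert x X = insert x (outer U0)"
    using w0'(4,6) unfolding outer_def cut_def by auto
  then show "cut T \<subseteq> cl (insert x (outer U0))" using w0'(11) by simp
  show "indep N (insert x (outer U0))"
    by (rule indep_subset[OF w0'(10)]) (auto simp: outer_def)
qed

lemma T_not_S: "T \<noteq> S"
proof
  assume TS: "T = S"
  have sub: "insert x (outer U0) \<subseteq> insert x (L \<union> X)"
    using w0'(6,9) TS unfolding outer_def by auto
  have "b \<in> cut T" using st'(3) b(1) TS by auto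
  moreover have "b \<notin> insert x (outer U0)"
    using b xi(1) st'(5) unfolding outer_def by auto
  ultimately have "\<not> indep N (insert b (insert x (outer U0)))"
    using cut_T_cl(1) unfolding cl_def by auto
  moreover have "insert b (insert x (outer U0)) \<subseteq> insert x (L \<union> X)" using sub b(1) by auto
  ultimately show False using indep_subset[OF xi(2)] by metis
qed

text \<open>A token that leaves \<open>T\<close> completes an augmenting path: its last edge replaces \<open>x\<close> in the
  spanning set of the cut, so \<open>T\<close> is the side of a wave that does not need \<open>x\<close>.\<close>

lemma no_exit:
  "reach U p z \<Longrightarrow> cl (outer U) = cl (outer U0) \<and> (\<forall>y. z = Some y \<longrightarrow> head D y \<in> T)"
proof (induction rule: reach.induct)
  case init
  show ?case by simp
next
  case (push U p z f)
  have gU: "good U" using reach_good push.hyps(1) by blast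
  have r': "reach (insert f U) (p(f := the z)) (Some f)" by (rule reach.push[OF push.hyps])
  then have gU': "good (insert f U)" and l': "linking L (insert f U) (p(f := the z))"
    using reach_good by auto
  note f = pushableD[OF push.hyps(2)]
  show ?case
  proof (cases "head D f \<in> T")
    case True
    then have "outer (insert f U) = outer U" unfolding outer_def by auto
    then show ?thesis using push.IH True by simp
  next
    case False
    have eq: "outer (insert f U) = insert f (outer U)" using False unfolding outer_def by auto
    have ind: "indep N (insert f (outer U))" using indep_outer[OF gU'] eq by simp
    have fn: "f \<notin> outer U" using f(2,3) unfolding outer_def by auto
    have fg: "f \<in> ground N" using f(1) ground_N by simp
    have "f \<notin> cl (outer U)" using ind fn unfolding cl_def by simp
    then have fn0: "f \<notin> cl (outer U0)" using push.IH by simp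
    have g0: "good U0" using reach_good[OF reach.init] by blast
    have gr0: "outer U0 \<subseteq> ground N" using indep_subset_ground[OF indep_outer[OF g0]] .
    have i0: "indep N (insert f (outer U0))" using fn0 fg unfolding cl_def by auto
    have gr1: "insert f (outer U) \<subseteq> ground N" using indep_subset_ground[OF ind] .
    have c1: "outer U0 \<subseteq> cl (insert f (outer U))"
      using subset_cl[OF gr0] push.IH cl_mono[of "outer U" "insert f (outer U)"] by auto
    then have c2: "insert f (outer U0) \<subseteq> cl (insert f (outer U))" using subset_cl[OF gr1] by auto
    have "f \<in> cut T" using f(1) source_tail[OF f(6)] False unfolding cut_def by simp
    then have fx: "f \<in> cl (insert x (outer U0))" using cut_T_cl(1) by auto
    have xg: "x \<in> ground N" using indep_subset_ground[OF cut_T_cl(2)] by auto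
    \<comment> \<open>Exchange: \<open>f\<close> is spanned with the help of \<open>x\<close> but
      not without it.\<close>
    have "x \<in> cl (insert f (outer U0))"
    proof (cases "f = x")
      case True
      then show ?thesis using xg by (simp add: cl_def)
    next
      case False
      then have "\<not> indep N (insert f (insert x (outer U0)))"
        using fx fn0 gr0 unfolding cl_def by auto
      then show ?thesis using xg by (simp add: cl_def insert_commute)
    qed
    then have "insert x (outer U0) \<subseteq> cl (insert f (outer U))"
      using c1 cl_trans[OF ind i0 c2] by auto
    then have "cut T \<subseteq> cl (insert f U \<inter> cut T \<union> X)"
      using cl_trans[OF ind cut_T_cl(2)] cut_T_cl(1) outer_eq[OF gU'] eq by auto
    then have "wave S L X T (insert f U) (p(f := the z))"
      using gU' l' w0'(1-3) unfolding wave_def good_def by blast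
    then show ?thesis using lo T_not_S unfolding loose_def by blast
  qed
next
  case (swap U p z f g)
  have gU: "good U" and l: "linking L U p" using reach_good swap.hyps(1) by auto
  have r': "reach (insert f (U - {g})) (\<lambda>u. if u = f then the z else if p u = g then f else p u) (prev p g)"
    by (rule reach.swap[OF swap.hyps(1-5)])
  have gU': "good (insert f (U - {g}))" using reach_good[OF r'] by blast
  note f = pushableD[OF swap.hyps(2)]
  have hd: "head D g = head D f" using swap_same_head[OF gU f(1) swap.hyps(3,5)] .
  have gX: "g \<notin> X" using goodD(2)[OF gU] swap.hyps(4) by auto
  have "cl (outer (insert f (U - {g}))) = cl (outer U)"
  proof (cases "head D f \<in> T")
    case True
    then have "outer (insert f (U - {g})) = outer U" using hd unfolding outer_def by auto
    then show ?thesis by simp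
  next
    case False
    have fU: "f \<in> cl (U \<union> X)" using swap.hyps(3) f(1) ground_N by (simp add: cl_def)
    have fcl: "f \<in> cl (outer U)"
      by (rule cl_localD[OF goodD(3)[OF gU] fU]) (use False in \<open>auto simp: outer_def\<close>)
    have gi: "g \<in> outer U" using swap.hyps(4) hd False unfolding outer_def by auto
    have eq: "outer (insert f (U - {g})) = insert f (outer U - {g})"
      using False gX unfolding outer_def by auto
    have "indep N (insert f (outer U - {g}))" using indep_outer[OF gU'] eq by simp
    moreover have "f \<notin> outer U" using f(2,3) unfolding outer_def by auto
    ultimately show ?thesis using cl_exchange[OF indep_outer[OF gU] gi fcl] eq by simp
  qed
  moreover have "head D y \<in> T" if "prev p g = Some y" for y
    using that linkingD(2)[OF l swap.hyps(4)] goodD(4)[OF gU swap.hyps(4)] unfolding prev_def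
    by (auto split: if_splits)
  ultimately show ?case using swap.IH by simp
next
  case (pull U p y g)
  have gU: "good U" and l: "linking L U p" using reach_good pull.hyps(1) by auto
  have "outer (U - {g}) = outer U" using pull.hyps(2,4) unfolding outer_def by auto
  moreover have "head D y' \<in> T" if "prev p g = Some y'" for y'
    using that linkingD(2)[OF l pull.hyps(3)] goodD(4)[OF gU pull.hyps(3)] unfolding prev_def
    by (auto split: if_splits)
  ultimately show ?case using pull.IH by simp
qed

text \<open>As the token never leaves \<open>T\<close>, the set \<open>reached\<close> is the side
  of a wave for the problem without \<open>x\<close>, whose trails are the initial edges with
  reached tail. That problem is unhindered, but this wave misses \<open>b\<close>.\<close>

lemma contradiction: False
proof -
  define U1 where "U1 = {u \<in> U0. tail D u \<in> reached}"
  have g0: "good U0" and l0: "linking L U0 p0" using reach_good[OF reach.init] by auto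
  have rT: "reached \<subseteq> T" using no_exit w0'(1) unfolding reached_def by auto
  have rV: "reached \<subseteq> verts D" using rT w0'(2) by auto
  \<comment> \<open>If \<open>g\<close> is still present when the token stands at its head, it can
    be pulled; otherwise the token has been at its tail when \<open>g\<close> was removed.\<close>
  have back_closed: "tail D g \<in> reached" if g: "g \<in> U0" "head D g \<in> reached" for g
  proof -
    have "head D g \<notin> S" using goodD(5)[OF g0 g(1)] .
    then obtain y U p where r: "reach U p (Some y)" "head D g = head D y"
      using g(2) unfolding reached_def by auto
    show ?thesis
    proof (cases "g \<in> U")
      case True
      have "head D y \<in> T" using no_exit[OF r(1)] by blast
      from reach.pull[OF r(1) this True r(2)] show ?thesis
        using prev_reached reach_good[OF r(1)] True by blast
    next
      case False
      then show ?thesis using removed_reached[OF r(1) g(1)] by blast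
    qed
  qed
  have lk: "linking L U1 p0"
  proof (rule linking_restrict[OF l0])
    show "U1 \<subseteq> U0" unfolding U1_def by auto
    fix u assume u: "u \<in> U1" "u \<notin> L"
    then have "u \<in> U0" "tail D u \<in> reached" unfolding U1_def by auto
    then have "p0 u \<in> U0" "head D (p0 u) \<in> reached" using linkingD(1,2)[OF l0] u by auto
    then show "p0 u \<in> U1" using back_closed unfolding U1_def by auto
  qed
  have g1: "good U1" by (rule good_mono[OF g0]) (auto simp: U1_def)
  have eq: "U1 \<inter> cut reached \<union> X = inner U0"
    using goodD(1)[OF g0] unfolding U1_def cut_def inner_def by auto
  have "cut reached \<subseteq> cl (inner U0)"
  proof
    fix f assume f: "f \<in> cut reached"
    then have f': "f \<in> arcs D" "tail D f \<in> reached" "head D f \<notin> reached" by (auto dest: cutD)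
    show "f \<in> cl (inner U0)"
    proof (cases "tail D f \<in> S")
      case False
      then obtain y U p where r: "reach U p (Some y)" "tail D f = head D y"
        using f'(2) unfolding reached_def by auto
      have "source (Some y) f" using r(2) no_exit[OF r(1)] by simp
      then show ?thesis using arc_out_of_reached[OF r(1) f'(1) _ f'(3)] by blast
    next
      case True
      have iLX: "indep N (L \<union> X)" by (rule st'(6))
      have "f \<in> cut S" using f'(1,3) True unfolding cut_def reached_def by auto
      then have "f \<in> cl (L \<union> X)" using st'(7) by auto
      \<comment> \<open>An edge leaving \<open>S\<close> need not be a root, so it may not be
        pushable. It is spanned by the members of \<open>L \<union> X\<close> with the same head,
        and each of these is spanned by \<open>inner U0\<close>.\<close>
      define K where "K = {l \<in> L \<union> X. head D l = head D f}"
      have iK: "indep N K" by (rule indep_subset[OF iLX]) (auto simp: K_def)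
      have "f \<in> cl K"
        by (rule cl_localD[OF iLX \<open>f \<in> cl (L \<union> X)\<close>]) (auto simp: K_def)
      moreover have "K \<subseteq> cl (inner U0)"
      proof
        fix l assume l: "l \<in> K"
        have lg: "l \<in> ground N" using l indep_subset_ground[OF iK] by auto
        show "l \<in> cl (inner U0)"
        proof (cases "l \<in> X")
          case True
          then show ?thesis using lg unfolding cl_def inner_def by simp
        next
          case False
          then have "l \<in> L" "head D l \<notin> reached" using l f'(3) unfolding K_def by auto
          then show ?thesis using arc_out_of_reached[OF reach.init] lg ground_N by simp
        qed
      qed
      ultimately show ?thesis using cl_trans[OF indep_inner[OF g0] iK] by auto
    qed
  qed
  moreover have "t \<notin> reached" using rT w0'(3) by auto
  moreover have "S \<subseteq> reached" unfolding reached_def by auto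
  ultimately have "wave S L X reached U1 p0"
    unfolding wave_def eq using lk rV goodD[OF g1] unfolding U1_def by auto
  then have "L \<subseteq> U1" using loose_imp_unhindered[OF st lo] unfolding unhindered_def by blast
  then show False using b unfolding U1_def by auto
qed

end

lemma (in matroid_network) loose_delete_arc:
  assumes st: "state S L X" and lo: "loose S L X" and "x \<notin> L" "indep N (insert x (L \<union> X))"
  shows "unhindered S L (insert x X)"
  unfolding unhindered_def
proof (intro allI impI subsetI, rule ccontr)
  fix T U p b assume "wave S L (insert x X) T U p" "b \<in> L" "b \<notin> U"
  then interpret augmentation D N t S T L X U p x b
    using assms by unfold_locales auto
  show False by (rule contradiction)
qed

section \<open>Linking one root to the sink\<close>

context matroid_network
begin

lemma cas_append: "cas u p v \<Longrightarrow> cas v q w \<Longrightarrow> cas u (p @ q) w"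
  by (induction p arbitrary: u) auto

lemma linking_insert_root:
  assumes l: "linking (L - {e}) U p" and e: "e \<notin> U"
  shows "linking L U p"
proof -
  have "F - L = F - (L - {e})" if "F \<subseteq> U" for F using e that by auto
  then show ?thesis using l unfolding linking_def by (metis order_refl)
qed

text \<open>
  \<open>Y - X\<close> consists of edges lying on walks that start with \<open>e\<close>; all other roots have been continued to
  the ends of the wave with side \<open>T\<close>.
\<close>

definition progress where
  "progress S L X e Y T U p \<longleftrightarrow> state S (L - {e}) Y \<and> kept_wave S (L - {e}) Y T U p \<and>
    loose T (U \<inter> cut T) Y \<and> full (L - {e}) T U p \<and> insert e X \<subseteq> Y \<and>
    (\<forall>x\<in>Y - X. head D x \<notin> S \<and>
      (\<exists>P. cas (head D e) P (head D x) \<and> set P \<subseteq> {y \<in> Y - X. tail D y \<notin> S}))"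

lemma progressD:
  assumes "progress S L X e Y T U p"
  shows "state S (L - {e}) Y" "kept_wave S (L - {e}) Y T U p" "loose T (U \<inter> cut T) Y"
    "full (L - {e}) T U p" "insert e X \<subseteq> Y" "\<And>x. x \<in> Y \<Longrightarrow> x \<notin> X \<Longrightarrow> head D x \<notin> S"
    "\<And>x. x \<in> Y \<Longrightarrow> x \<notin> X \<Longrightarrow>
      \<exists>P. cas (head D e) P (head D x) \<and> set P \<subseteq> {y \<in> Y - X. tail D y \<notin> S}"
  using assms unfolding progress_def by auto

lemma progress_exists:
  assumes st: "state S L X" and lo: "loose S L X" and e: "e \<in> L"
  obtains T U p where "progress S L X e (insert e X) T U p"
proof -
  note d = unhindered_delete_root[OF st loose_imp_unhindered[OF st lo] e]
  obtain T U p where w: "kept_wave S (L - {e}) (insert e X) T U p"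
    "loose T (U \<inter> cut T) (insert e X)"
    using maximal_wave[OF d(1)] by blast
  have "full (L - {e}) T U p" using unhindered_full[OF d(2)] w(1) unfolding kept_wave_def by blast
  moreover have "head D e \<notin> S" using e stateD(3)[OF st] by (auto dest: cutD)
  moreover have "\<exists>P. cas (head D e) P (head D e) \<and> set P \<subseteq> {y \<in> insert e X - X. tail D y \<notin> S}"
    by (intro exI[of _ "[]"]) simp
  ultimately have "progress S L X e (insert e X) T U p"
    unfolding progress_def using d(1) w by auto
  then show ?thesis by (rule that)
qed

text \<open>Forbidding \<open>f\<close> does not disturb the wave inside \<open>T\<close>, since the
  head of \<open>f\<close> lies outside. Looseness beyond \<open>T\<close> makes the new problem
  there unhindered, so a maximal wave continues all current ends and fullness is preserved.\<close>

lemma progress_step: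
  assumes pr: "progress S L X e Y T U p"
    and f: "f \<in> arcs D" "x \<in> Y" "x \<notin> X" "head D x = tail D f" "head D f \<notin> T"
      "f \<notin> cl (U \<inter> cut T \<union> Y)"
  obtains T' U' p' where "progress S L X e (insert f Y) T' U' p'" "ext T U p T' U' p'"
proof -
  note pr' = progressD[OF pr]
  have k: "wave S (L - {e}) Y T U p" using pr'(2) unfolding kept_wave_def by blast
  note k' = waveD[OF k]
  have stT: "state T (U \<inter> cut T) Y" by (rule state_of_wave[OF pr'(1) k])
  note stT' = stateD[OF stT]
  have fg: "f \<in> ground N" using f(1) ground_N by simp
  have fn: "f \<notin> U \<inter> cut T" "f \<notin> Y" "indep N (insert f (U \<inter> cut T \<union> Y))"
    using f(6) fg unfolding cl_def by auto
  have un: "unhindered T (U \<inter> cut T) (insert f Y)"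
    by (rule loose_delete_arc[OF stT pr'(3) fn(1,3)])
  have i: "indep N (U \<inter> cut T \<union> insert f Y)" using fn(3) by simp
  have m: "kept_wave S (L - {e}) (insert f Y) T U p" "state S (L - {e}) (insert f Y)"
    by (rule wave_more_forbidden[OF pr'(1,2) _ _ _ i]; use f(1,5) fn(1) stT'(4,5) in auto)+
  have st2: "state T (U \<inter> cut T) (insert f Y)"
    using state_of_wave[OF m(2)] m(1) unfolding kept_wave_def by blast
  obtain T' U' p' where w: "kept_wave T (U \<inter> cut T) (insert f Y) T' U' p'"
    "loose T' (U' \<inter> cut T') (insert f Y)"
    using maximal_wave[OF st2] by blast
  note c = compose_waves[OF m(2,1) w(1)]
  note cf = compose_full[OF m(2,1) w(1) pr'(4) un]
  have tS: "tail D f \<notin> S" using pr'(6)[OF f(2,3)] f(4) by simp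
  have hS: "head D f \<notin> S" using f(5) k'(1) by auto
  have P: "\<exists>P. cas (head D e) P (head D y) \<and> set P \<subseteq> {z \<in> insert f Y - X. tail D z \<notin> S}"
    if y: "y \<in> insert f Y" "y \<notin> X" for y
  proof (cases "y = f")
    case False
    then obtain P where "cas (head D e) P (head D y)" "set P \<subseteq> {z \<in> Y - X. tail D z \<notin> S}"
      using pr'(7)[of y] y by auto
    then show ?thesis by (intro exI[of _ P]) auto
  next
    case True
    obtain P where P: "cas (head D e) P (head D x)" "set P \<subseteq> {z \<in> Y - X. tail D z \<notin> S}"
      using pr'(7)[OF f(2,3)] by blast
    have "cas (head D e) (P @ [f]) (head D f)" by (rule cas_append[OF P(1)]) (simp add: f(4))
    then show ?thesis using P(2) True y tS by (intro exI[of _ "P @ [f]"]) auto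
  qed
  have hh: "head D y \<notin> S" if "y \<in> insert f Y" "y \<notin> X" for y
    using that pr'(6)[of y] hS by auto
  have "progress S L X e (insert f Y) T' ({u \<in> U. head D u \<in> T} \<union> U') (\<lambda>u. if u \<in> U then p u else p' u)"
    unfolding progress_def c(3) using m(2) c(1) w(2) cf pr'(5) P hh by auto
  then show ?thesis using that c(2) by blast
qed

text \<open>An edge may become eligible late, so \<open>fair\<close> attends to each edge at
  arbitrarily late stages. An edge leaving the limit set from \<open>H\<close> is then found spanned
  or added; adding it would put its head into \<open>H\<close>.\<close>

lemma progress_limit:
  assumes st: "state S L X" and lo: "loose S L X" and e: "e \<in> L"
    and pr: "\<And>n :: nat. progress S L X e (Y n) (T n) (U n) (p n)"
    and ex: "\<And>n. ext (T n) (U n) (p n) (T (Suc n)) (U (Suc n)) (p (Suc n))"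
    and mono: "\<And>n. Y n \<subseteq> Y (Suc n)"
    and fair: "\<And>f m. f \<in> arcs D \<Longrightarrow> \<exists>n\<ge>m. \<forall>x\<in>Y n - X. head D x = tail D f \<longrightarrow> head D f \<notin> T n \<longrightarrow>
      f \<notin> cl (U n \<inter> cut (T n) \<union> Y n) \<longrightarrow> f \<in> Y (Suc n)"
  shows "\<exists>n. \<exists>x\<in>Y n - X. head D x = t"
proof (rule ccontr)
  assume nt: "\<not> ?thesis"
  note pr' = progressD[OF pr]
  have mY: "Y m \<subseteq> Y n" if "m \<le> n" for m n using lift_Suc_mono_le[of Y, OF mono that] .
  obtain U' p' where lim: "kept_wave S (L - {e}) (\<Union>n. Y n) (\<Union>n. T n) U' p'"
    "\<And>n. ext (T n) (U n) (p n) (\<Union>n. T n) U' p'"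
    by (rule wave_limit[of S "L - {e}" Y T U p]) (use pr'(2) ex mono in auto)
  define Yw where "Yw = (\<Union>n. Y n)"
  define Tw where "Tw = (\<Union>n. T n)"
  define H where "H = head D ` (Yw - X)"
  have w: "wave S (L - {e}) Yw Tw U' p'" using lim(1) unfolding kept_wave_def Yw_def Tw_def by blast
  note w' = waveD[OF w] and st' = stateD[OF st]
  have XY: "insert e X \<subseteq> Yw" using pr'(5) unfolding Yw_def by blast
  have Yarcs: "Yw \<subseteq> arcs D" using stateD(4)[OF pr'(1)] unfolding Yw_def by auto
  have HV: "H \<subseteq> verts D" using Yarcs unfolding H_def by auto
  have tH: "t \<notin> H" using nt unfolding H_def Yw_def by auto
  have eU: "e \<notin> U'" using w'(5) XY by auto
  \<comment> \<open>Edges of \<open>Yw - X\<close> have heads in \<open>H\<close> and so do not help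
    to span an edge leaving \<open>Tw \<union> H\<close>. This returns from \<open>Yw\<close> to the
    original \<open>X\<close>.\<close>
  have red: "f \<in> cl (U' \<inter> cut (Tw \<union> H) \<union> X)"
    if f: "f \<in> cl (U' \<inter> cut Tw \<union> Yw)" "head D f \<notin> Tw \<union> H" for f
  proof (rule cl_localD[OF _ f(1)])
    show "indep N (U' \<inter> cut Tw \<union> Yw)" by (rule indep_subset[OF w'(10)]) auto
    show "(U' \<inter> cut Tw \<union> Yw) \<inter> {a. head D a = head D f} \<subseteq> U' \<inter> cut (Tw \<union> H) \<union> X"
    proof
      fix a assume a: "a \<in> (U' \<inter> cut Tw \<union> Yw) \<inter> {a. head D a = head D f}"
      then have "head D a \<notin> Tw" "head D a \<notin> H" using f(2) by auto
      moreover from this(2) have "a \<notin> Yw - X" unfolding H_def by blast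
      ultimately show "a \<in> U' \<inter> cut (Tw \<union> H) \<union> X" using a unfolding cut_def by auto
    qed
  qed
  have "f \<in> cl (U' \<inter> cut Tw \<union> Yw)" if f: "f \<in> cut (Tw \<union> H)" for f
  proof (cases "tail D f \<in> Tw")
    case True
    then have "f \<in> cut Tw" using f unfolding cut_def by auto
    then show ?thesis using w'(11) by auto
  next
    case False
    have f': "f \<in> arcs D" "head D f \<notin> Tw" "head D f \<notin> H" using f unfolding cut_def by auto
    obtain x m where x: "x \<in> Y m" "x \<notin> X" "head D x = tail D f"
      using f False unfolding cut_def H_def Yw_def by auto
    obtain n where n: "n \<ge> m" "\<forall>x\<in>Y n - X. head D x = tail D f \<longrightarrow> head D f \<notin> T n \<longrightarrow>
      f \<notin> cl (U n \<inter> cut (T n) \<union> Y n) \<longrightarrow> f \<in> Y (Suc n)"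
      using fair[OF f'(1)] by blast
    have xn: "x \<in> Y n - X" using mY[OF n(1)] x by auto
    have hT: "head D f \<notin> T n" using f'(2) unfolding Tw_def by auto
    have kn: "wave S (L - {e}) (Y n) (T n) (U n) (p n)" using pr'(2) unfolding kept_wave_def by blast
    show ?thesis
    proof (cases "f \<in> cl (U n \<inter> cut (T n) \<union> Y n)")
      case True
      show ?thesis
      proof (rule cl_localD[OF _ True])
        show "indep N (U n \<inter> cut (T n) \<union> Y n)" by (rule indep_subset[OF waveD(10)[OF kn]]) auto
        show "(U n \<inter> cut (T n) \<union> Y n) \<inter> {a. head D a = head D f} \<subseteq> U' \<inter> cut Tw \<union> Yw"
        proof
          fix a assume a: "a \<in> (U n \<inter> cut (T n) \<union> Y n) \<inter> {a. head D a = head D f}"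
          show "a \<in> U' \<inter> cut Tw \<union> Yw"
          proof (cases "a \<in> Y n")
            case True
            then show ?thesis unfolding Yw_def by auto
          next
            case False
            then have a': "a \<in> U n" "a \<in> cut (T n)" "head D a \<notin> Tw" using a f'(2) by auto
            then have "a \<in> U'" using lim(2)[of n] unfolding ext_def Tw_def by auto
            moreover have "a \<in> cut Tw" using a'(2,3) unfolding cut_def Tw_def by auto
            ultimately show ?thesis by auto
          qed
        qed
      qed
    next
      case False
      then have "f \<in> Y (Suc n)" using n(2) xn x(3) hT by blast
      moreover have "f \<notin> Y n" using False f'(1) ground_N unfolding cl_def by auto
      then have "f \<notin> X" using pr'(5)[of n] by auto
      ultimately have "head D f \<in> H" unfolding H_def Yw_def by auto
      then show ?thesis using f'(3) by simp
    qed
  qed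
  then have "cut (Tw \<union> H) \<subseteq> cl (U' \<inter> cut (Tw \<union> H) \<union> X)"
    using red by (auto dest: cutD)
  moreover have "indep N (U' \<union> X)" by (rule indep_subset[OF w'(10)]) (use XY in auto)
  moreover have "U' \<inter> X = {}" using w'(5) XY by auto
  moreover have "u \<in> L \<or> tail D u \<notin> S" if "u \<in> U'" for u using w'(9)[OF that] by blast
  ultimately have "wave S L X (Tw \<union> H) U' p'"
    unfolding wave_def using w'(1-4,6-8) HV tH linking_insert_root[OF w'(12) eU] by auto
  then show False
    using loose_imp_unhindered[OF st lo] e eU unfolding unhindered_def by blast
qed

lemma link_one:
  assumes st: "state S L X" and lo: "loose S L X" and e: "e \<in> L"
  obtains Y T U p P where "progress S L X e Y T U p" "cas (head D e) P t"
    "set P \<subseteq> {y \<in> Y - X. tail D y \<notin> S}"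
proof -
  \<comment> \<open>Decoding pairs lets every edge occur at arbitrarily large indices, as fairness
    requires.\<close>
  define a where "a n = from_nat_into (arcs D) (fst (prod_decode n))" for n
  define Q where "Q w \<longleftrightarrow> (case w of (Y, T, U, p) \<Rightarrow> progress S L X e Y T U p)" for w
  define E where "E n w w' \<longleftrightarrow> (case w of (Y, T, U, p) \<Rightarrow> case w' of (Y', T', U', p') \<Rightarrow>
    ext T U p T' U' p' \<and> Y \<subseteq> Y' \<and> (\<forall>x\<in>Y - X. head D x = tail D (a n) \<longrightarrow> head D (a n) \<notin> T \<longrightarrow>
      a n \<notin> cl (U \<inter> cut T \<union> Y) \<longrightarrow> a n \<in> Y'))" for n w w'
  have ne: "arcs D \<noteq> {}" using e stateD(3)[OF st] by (auto dest: cutD)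
  have aA: "a n \<in> arcs D" for n unfolding a_def using from_nat_into[OF ne] .
  obtain T0 U0 p0 where "progress S L X e (insert e X) T0 U0 p0"
    using progress_exists[OF st lo e] by blast
  then have ex0: "\<exists>w. Q w" unfolding Q_def by auto
  have exS: "\<exists>w'. Q w' \<and> E n w w'" if Qw: "Q w" for w n
  proof -
    obtain Y T U p where w: "w = (Y, T, U, p)" by (cases w) auto
    have pr: "progress S L X e Y T U p" using Qw unfolding Q_def w by simp
    show ?thesis
    proof (cases "\<exists>x\<in>Y - X. head D x = tail D (a n) \<and> head D (a n) \<notin> T \<and> a n \<notin> cl (U \<inter> cut T \<union> Y)")
      case True
      then obtain x where x: "x \<in> Y" "x \<notin> X" "head D x = tail D (a n)" "head D (a n) \<notin> T"
        "a n \<notin> cl (U \<inter> cut T \<union> Y)" by auto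
      obtain T' U' p' where "progress S L X e (insert (a n) Y) T' U' p'" "ext T U p T' U' p'"
        using progress_step[OF pr aA x] by blast
      then show ?thesis unfolding Q_def E_def w by (intro exI[of _ "(insert (a n) Y, T', U', p')"]) auto
    next
      case False
      then show ?thesis using pr ext_refl unfolding Q_def E_def w by (intro exI[of _ "(Y, T, U, p)"]) auto
    qed
  qed
  obtain g where g: "\<And>n. Q (g n)" "\<And>n. E n (g n) (g (Suc n))"
    using dependent_nat_choice[of "\<lambda>_. Q" E] ex0 exS by metis
  define Y where "Y n = fst (g n)" for n
  define T where "T n = fst (snd (g n))" for n
  define U where "U n = fst (snd (snd (g n)))" for n
  define p where "p n = snd (snd (snd (g n)))" for n
  have gg: "g n = (Y n, T n, U n, p n)" for n unfolding Y_def T_def U_def p_def by simp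
  have pr: "progress S L X e (Y n) (T n) (U n) (p n)" for n using g(1)[of n] unfolding Q_def gg by simp
  have ex: "ext (T n) (U n) (p n) (T (Suc n)) (U (Suc n)) (p (Suc n))" "Y n \<subseteq> Y (Suc n)"
    "\<forall>x\<in>Y n - X. head D x = tail D (a n) \<longrightarrow> head D (a n) \<notin> T n \<longrightarrow>
      a n \<notin> cl (U n \<inter> cut (T n) \<union> Y n) \<longrightarrow> a n \<in> Y (Suc n)" for n
    using g(2)[of n] unfolding E_def gg by auto
  have "\<exists>n. \<exists>x\<in>Y n - X. head D x = t"
  proof (rule progress_limit[where Y = Y and T = T and U = U and p = p, OF st lo e pr ex(1,2)])
    fix f m assume "f \<in> arcs D"
    then obtain i where i: "f = from_nat_into (arcs D) i"
      using range_from_nat_into[OF ne countable_arcs] by auto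
    define n where "n = prod_encode (i, m)"
    have "a n = f" unfolding a_def n_def i by simp
    moreover have "n \<ge> m" unfolding n_def by (rule le_prod_encode_2)
    ultimately show "\<exists>n\<ge>m. \<forall>x\<in>Y n - X. head D x = tail D f \<longrightarrow> head D f \<notin> T n \<longrightarrow>
      f \<notin> cl (U n \<inter> cut (T n) \<union> Y n) \<longrightarrow> f \<in> Y (Suc n)"
      using ex(3)[of n] by auto
  qed
  then obtain n x where x: "x \<in> Y n" "x \<notin> X" "head D x = t" by auto
  then show ?thesis using progressD(7)[OF pr x(1,2)] that[OF pr] by metis
qed

section \<open>Linking all roots\<close>

lemma single_valued_pred_rel: "single_valued (pred_rel L U p)"
  unfolding single_valued_def pred_rel_def by auto

lemma single_valued_converse_pred_rel:
  assumes "linking L U p"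
  shows "single_valued ((pred_rel L U p)\<inverse>)"
  using inj_onD[OF linkingD(3)[OF assms]] unfolding single_valued_def pred_rel_def by auto

lemma pred_rel_rtrancl_in:
  assumes "linking L U p" "(u, w) \<in> (pred_rel L U p)\<^sup>*" "u \<in> U"
  shows "w \<in> U"
  using assms(2,3) by (induction rule: rtrancl_induct) (auto simp: pred_rel_def linkingD(1)[OF assms(1)])

lemma pred_rel_rtrancl_head:
  assumes l: "linking L U p" and r: "(u, w) \<in> (pred_rel L U p)\<^sup>*" and t: "\<And>y. y \<in> U \<Longrightarrow> tail D y \<in> T"
  shows "w = u \<or> head D w \<in> T"
  using r
proof (cases rule: rtranclE)
  case (step y)
  then show ?thesis using linkingD(2)[OF l, of y] t[of y] unfolding pred_rel_def by auto
qed simp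

lemma pred_rel_root_unique:
  assumes "(z, l) \<in> (pred_rel L U p)\<^sup>*" "(z, l') \<in> (pred_rel L U p)\<^sup>*" "l \<in> L" "l' \<in> L"
  shows "l = l'"
proof -
  have "w = k" if "(k, w) \<in> (pred_rel L U p)\<^sup>*" "k \<in> L" for k w
    using that by (cases rule: converse_rtranclE) (auto simp: pred_rel_def)
  then show ?thesis
    using single_valued_confluent[OF single_valued_pred_rel assms(1,2)] assms(3,4) by metis
qed

text \<open>By injectivity, two edges from which \<open>z\<close> is reached lie on one chain. If
  they differed, one would precede an edge, whose tail in \<open>T\<close> is its head.\<close>

lemma pred_rel_top_unique:
  assumes l: "linking L U p" and "(u, z) \<in> (pred_rel L U p)\<^sup>*" "(u', z) \<in> (pred_rel L U p)\<^sup>*"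
    and t: "\<And>y. y \<in> U \<Longrightarrow> tail D y \<in> T" and "head D u \<notin> T" "head D u' \<notin> T"
  shows "u = u'"
proof -
  have "(z, u) \<in> ((pred_rel L U p)\<inverse>)\<^sup>*" "(z, u') \<in> ((pred_rel L U p)\<inverse>)\<^sup>*"
    using assms(2,3) by (auto simp: rtrancl_converse)
  then have "(u, u') \<in> ((pred_rel L U p)\<inverse>)\<^sup>* \<or> (u', u) \<in> ((pred_rel L U p)\<inverse>)\<^sup>*"
    using single_valued_confluent[OF single_valued_converse_pred_rel[OF l]] by blast
  then have "(u', u) \<in> (pred_rel L U p)\<^sup>* \<or> (u, u') \<in> (pred_rel L U p)\<^sup>*"
    by (auto simp: rtrancl_converse)
  then show ?thesis
    using pred_rel_rtrancl_head[OF l _ t] assms(5,6) by blast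
qed

lemma pred_rel_walk:
  assumes l: "linking L U p" and "(u, v) \<in> (pred_rel L U p)\<^sup>*"
  shows "\<exists>q. cas (head D v) q (head D u) \<and> (u = v \<or> u \<in> set q) \<and>
    (\<forall>w\<in>set q. w \<in> U - L \<and> (u, w) \<in> (pred_rel L U p)\<^sup>* \<and> (w, v) \<in> (pred_rel L U p)\<^sup>*)"
  using assms(2)
proof (induction rule: rtrancl_induct)
  case base
  show ?case by (intro exI[of _ "[]"]) simp
next
  case (step y z)
  then obtain q where q: "cas (head D y) q (head D u)" "u = y \<or> u \<in> set q"
    "\<forall>w\<in>set q. w \<in> U - L \<and> (u, w) \<in> (pred_rel L U p)\<^sup>* \<and> (w, y) \<in> (pred_rel L U p)\<^sup>*" by blast
  have y: "y \<in> U" "y \<notin> L" "z = p y" using step.hyps(2) unfolding pred_rel_def by auto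
  have "cas (head D z) (y # q) (head D u)" using q(1) linkingD(2)[OF l y(1,2)] y(3) by simp
  moreover have "w \<in> U - L \<and> (u, w) \<in> (pred_rel L U p)\<^sup>* \<and> (w, z) \<in> (pred_rel L U p)\<^sup>*"
    if "w \<in> set (y # q)" for w
  proof (cases "w = y")
    case True
    then show ?thesis using y step.hyps by auto
  next
    case False
    then have "w \<in> set q" using that by simp
    then show ?thesis using q(3) step.hyps(2) by (meson rtrancl.rtrancl_into_rtrancl)
  qed
  moreover have "u = z \<or> u \<in> set (y # q)" using q(2) by auto
  ultimately show ?case by blast
qed

text \<open>Nothing in \<open>F\<close> follows \<open>u\<close>, so \<open>F\<close> stays closed
  when \<open>u\<close> is removed, and by injectivity nothing left follows \<open>p u\<close>. The
  finite set shrinks until a root is met.\<close>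

lemma pred_rel_reaches_root:
  assumes l: "linking L U p"
  shows "finite F \<Longrightarrow> F \<subseteq> U \<Longrightarrow> u \<in> F \<Longrightarrow> p ` (F - L) \<subseteq> F \<Longrightarrow> (\<forall>w\<in>F - L. p w \<noteq> u) \<Longrightarrow>
    \<exists>r\<in>L. (u, r) \<in> (pred_rel L U p)\<^sup>*"
proof (induction F arbitrary: u rule: finite_psubset_induct)
  case (psubset F)
  show ?case
  proof (cases "u \<in> L")
    case True
    then show ?thesis by blast
  next
    case False
    have pu: "p u \<in> F - {u}" using psubset.prems False by auto
    have uU: "u \<in> U" using psubset.prems by auto
    have "p w \<noteq> p u" if "w \<in> F - {u} - L" for w
      using inj_onD[OF linkingD(3)[OF l], of w u] that psubset.prems(1,2) False by auto
    moreover have "p ` (F - {u} - L) \<subseteq> F - {u}" using psubset.prems by auto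
    moreover have "F - {u} \<subset> F" using psubset.prems by auto
    ultimately obtain r where "r \<in> L" "(p u, r) \<in> (pred_rel L U p)\<^sup>*"
      using psubset.IH[of "F - {u}" "p u"] pu psubset.prems(1) by blast
    moreover have "(u, p u) \<in> pred_rel L U p" using uU False unfolding pred_rel_def by auto
    ultimately show ?thesis by (meson converse_rtrancl_into_rtrancl)
  qed
qed

text \<open>
  \<open>F\<close> is the set of roots whose walk \<open>c l\<close> has arrived at \<open>t\<close>; the other walks end with the edge
  \<open>d l\<close> leaving \<open>S\<close>.
\<close>

definition stage where
  "stage s S0 L0 S L X F c d \<longleftrightarrow> state S L X \<and> loose S L X \<and> S0 \<subseteq> S \<and>
    (\<forall>l\<in>L0. l \<in> set (c l) \<and> set (c l) \<inter> L0 \<subseteq> {l} \<and>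
      (if l \<in> F then cas s (c l) t
       else cas s (c l) (head D (d l)) \<and> d l \<in> L \<and> d l \<in> set (c l)) \<and>
      (\<forall>z\<in>set (c l). head D z \<in> S \<or> (if l \<in> F then z \<in> X else z = d l))) \<and>
    (\<forall>l\<in>L0. \<forall>l'\<in>L0. l \<noteq> l' \<longrightarrow> set (c l) \<inter> set (c l') = {}) \<and>
    indep N ((\<Union>l\<in>L0. set (c l)) \<union> X)"

lemma stageD:
  assumes "stage s S0 L0 S L X F c d"
  shows "state S L X" "loose S L X" "S0 \<subseteq> S"
    "\<And>l. l \<in> L0 \<Longrightarrow> l \<in> set (c l)" "\<And>l. l \<in> L0 \<Longrightarrow> set (c l) \<inter> L0 \<subseteq> {l}"
    "\<And>l. l \<in> L0 \<Longrightarrow> l \<in> F \<Longrightarrow> cas s (c l) t"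
    "\<And>l. l \<in> L0 \<Longrightarrow> l \<notin> F \<Longrightarrow> cas s (c l) (head D (d l)) \<and> d l \<in> L \<and> d l \<in> set (c l)"
    "\<And>l z. l \<in> L0 \<Longrightarrow> z \<in> set (c l) \<Longrightarrow> head D z \<in> S \<or> (if l \<in> F then z \<in> X else z = d l)"
    "\<And>l l'. l \<in> L0 \<Longrightarrow> l' \<in> L0 \<Longrightarrow> l \<noteq> l' \<Longrightarrow> set (c l) \<inter> set (c l') = {}"
    "indep N ((\<Union>l\<in>L0. set (c l)) \<union> X)"
  using assms unfolding stage_def by (auto split: if_splits)

text \<open>A maximal independent set \<open>B\<close> of edges leaving \<open>s\<close> provides
  the roots. Each end of a maximal wave has its head outside \<open>S0\<close>, so no edge follows
  it and its chain leads back to \<open>B\<close>.\<close>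

lemma initial_stage:
  assumes s: "s \<in> verts D" "s \<noteq> t"
  obtains S0 L0 c d where "s \<in> S0" "t \<notin> S0" "L0 \<subseteq> cut S0" "indep N L0" "cut S0 \<subseteq> cl L0"
    "stage s S0 L0 S0 L0 {} {} c d"
proof -
  have gr: "cut {s} \<subseteq> ground N" using cutD(1) ground_N by auto
  obtain B where B: "maximal_in (cut {s}) B" using maximal_in_exists[OF indep_empty _ gr] by blast
  note B' = maximal_inD[OF B]
  have "cut {s} \<subseteq> cl B"
  proof
    fix a assume "a \<in> cut {s}"
    then show "a \<in> cl B" using B'(3)[of a] gr unfolding cl_def by auto
  qed
  then have st: "state {s} B {}" unfolding state_def using s B'(1,2) by auto
  obtain S0 U p where w: "kept_wave {s} B {} S0 U p" "state S0 (U \<inter> cut S0) {}" "loose S0 (U \<inter> cut S0) {}"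
    using maximal_wave[OF st] by blast
  have k: "wave {s} B {} S0 U p" using w(1) unfolding kept_wave_def by blast
  note k' = waveD[OF k] and lk = waveD(12)[OF k] and sw = stateD[OF w(2)]
  define L0 where "L0 = U \<inter> cut S0"
  let ?R = "(pred_rel B U p)\<^sup>*"
  have "\<exists>q. cas s q (head D l) \<and> l \<in> set q \<and> (\<forall>z\<in>set q. z \<in> U \<and> (l, z) \<in> ?R)" if l: "l \<in> L0" for l
  proof -
    have lU: "l \<in> U" "head D l \<notin> S0" using l unfolding L0_def cut_def by auto
    obtain F where F: "finite F" "l \<in> F" "F \<subseteq> U" "p ` (F - B) \<subseteq> F" using linkingD(4)[OF lk lU(1)] by blast
    have "p w \<noteq> l" if "w \<in> F - B" for w
      using linkingD(2)[OF lk, of w] k'(6)[of w] that F(3) lU(2) by auto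
    then obtain r where r: "r \<in> B" "(l, r) \<in> ?R"
      using pred_rel_reaches_root[OF lk F(1,3,2,4)] by blast
    obtain q where q: "cas (head D r) q (head D l)" "l = r \<or> l \<in> set q"
      "\<forall>w\<in>set q. w \<in> U - B \<and> (l, w) \<in> ?R \<and> (w, r) \<in> ?R" using pred_rel_walk[OF lk r(2)] by blast
    have "tail D r = s" using r(1) B'(2) unfolding cut_def by auto
    moreover have "r \<in> U" using pred_rel_rtrancl_in[OF lk r(2) lU(1)] .
    ultimately show ?thesis using q r by (intro exI[of _ "r # q"]) auto
  qed
  then obtain c where c: "\<And>l. l \<in> L0 \<Longrightarrow> cas s (c l) (head D l) \<and> l \<in> set (c l) \<and>
      (\<forall>z\<in>set (c l). z \<in> U \<and> (l, z) \<in> ?R)" by metis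
  have hd: "z = l \<or> head D z \<in> S0" if "l \<in> L0" "z \<in> set (c l)" for l z
    using pred_rel_rtrancl_head[OF lk _ k'(6)] c[OF that(1)] that(2) by blast
  have nh: "head D l \<notin> S0" if "l \<in> L0" for l using that unfolding L0_def cut_def by auto
  have "set (c l) \<inter> set (c l') = {}" if "l \<in> L0" "l' \<in> L0" "l \<noteq> l'" for l l'
    using pred_rel_top_unique[OF lk _ _ k'(6) nh[OF that(1)] nh[OF that(2)]] c[OF that(1)] c[OF that(2)] that(3)
    by blast
  moreover have "indep N ((\<Union>l\<in>L0. set (c l)) \<union> {})"
    by (rule indep_subset[OF k'(10)]) (use c in auto)
  moreover have "set (c l) \<inter> L0 \<subseteq> {l}" if "l \<in> L0" for l using hd[OF that] nh by blast
  moreover have hd': "\<forall>z\<in>set (c l). head D z \<in> S0 \<or> z = l" if "l \<in> L0" for l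
    using hd[OF that] by blast
  ultimately have "stage s S0 L0 S0 L0 {} {} c id"
    unfolding stage_def using w(2,3)[folded L0_def] c hd' by simp
  moreover have "s \<in> S0" "t \<notin> S0" using k'(1,3) by auto
  moreover have "indep N L0" "cut S0 \<subseteq> cl L0" "L0 \<subseteq> cut S0" using sw unfolding L0_def by auto
  ultimately show ?thesis by (intro that[of S0 L0 c id])
qed

text \<open>The walk of \<open>l0\<close> is completed by edges of \<open>Y\<close>, the other
  unfinished walks are prolonged along trails in \<open>U\<close>. These sets are disjoint, and
  different roots have different trails. An old edge enters \<open>S\<close> or lies in
  \<open>X \<union> L\<close>, a new one does neither.\<close>

lemma stage_step:
  assumes sg: "stage s S0 L0 S L X F c d" and l0: "l0 \<in> L0" "l0 \<notin> F" and L0: "L0 \<subseteq> cut S0"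
  obtains S' L' X' c' d' where "stage s S0 L0 S' L' X' (insert l0 F) c' d'"
    "\<And>l. l \<in> F \<Longrightarrow> c' l = c l"
proof -
  note sg' = stageD[OF sg]
  define e where "e = d l0"
  have e: "e \<in> L" "cas s (c l0) (head D e)" "e \<in> set (c l0)" using sg'(7)[OF l0] unfolding e_def by auto
  obtain Y T U p P where pr: "progress S L X e Y T U p" and P: "cas (head D e) P t"
    "set P \<subseteq> {y \<in> Y - X. tail D y \<notin> S}"
    using link_one[OF sg'(1,2) e(1)] by blast
  note pr' = progressD[OF pr] and st' = stateD[OF sg'(1)]
  have k: "wave S (L - {e}) Y T U p" using pr'(2) unfolding kept_wave_def by blast
  note k' = waveD[OF k] and lk = waveD(12)[OF k]
  have stT: "state T (U \<inter> cut T) Y" by (rule state_of_wave[OF pr'(1) k])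
  let ?R = "(pred_rel (L - {e}) U p)\<^sup>*"
  let ?O = "L0 - F - {l0}"
  have dL: "d l \<in> L - {e}" if l: "l \<in> ?O" for l
  proof -
    have "d l \<in> L" "d l \<in> set (c l)" using sg'(7)[of l] l by auto
    moreover have "set (c l) \<inter> set (c l0) = {}" using sg'(9)[of l l0] l l0 by auto
    ultimately show ?thesis using e(3) by auto
  qed
  have "\<exists>a q. a \<in> U \<inter> cut T \<and> (a, d l) \<in> ?R \<and> cas (head D (d l)) q (head D a) \<and> (a = d l \<or> a \<in> set q) \<and>
    (\<forall>z\<in>set q. z \<in> U - (L - {e}) \<and> (a, z) \<in> ?R \<and> (z, d l) \<in> ?R)" if l: "l \<in> ?O" for l
  proof -
    obtain a where a: "a \<in> U \<inter> cut T" "(a, d l) \<in> ?R" using pr'(4) dL[OF l] unfolding full_def by blast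
    then show ?thesis using pred_rel_walk[OF lk a(2)] by blast
  qed
  then obtain a q where aq: "\<And>l. l \<in> ?O \<Longrightarrow> a l \<in> U \<inter> cut T \<and> (a l, d l) \<in> ?R \<and>
    cas (head D (d l)) (q l) (head D (a l)) \<and> (a l = d l \<or> a l \<in> set (q l)) \<and>
    (\<forall>z\<in>set (q l). z \<in> U - (L - {e}) \<and> (a l, z) \<in> ?R \<and> (z, d l) \<in> ?R)" by metis
  define c' where "c' l = (if l \<in> F then c l else if l = l0 then c l @ P else c l @ q l)" for l
  have c'F: "c' l = c l" if "l \<in> F" for l using that unfolding c'_def by simp
  have c'0: "c' l0 = c l0 @ P" using l0 unfolding c'_def by simp
  have c'O: "c' l = c l @ q l" if "l \<in> ?O" for l using that unfolding c'_def by auto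
  have cases: "l \<in> F \<or> l = l0 \<or> l \<in> ?O" if "l \<in> L0" for l using that by auto
  have XY: "X \<subseteq> Y" "e \<in> Y" using pr'(5) by auto
  have eY: "tail D z \<notin> S" "head D z \<notin> S" "z \<in> U" "z \<notin> Y" "z \<notin> L" if "l \<in> ?O" "z \<in> set (q l)" for l z
  proof -
    have z: "z \<in> U" "z \<notin> L - {e}" using aq[OF that(1)] that(2) by auto
    show "z \<in> U" "z \<notin> Y" "head D z \<notin> S" "tail D z \<notin> S" using z k'(5,7,9) by auto
    then show "z \<notin> L" using z(2) XY(2) by auto
  qed
  have PP: "tail D z \<notin> S" "head D z \<notin> S" "z \<in> Y" "z \<notin> X" "z \<notin> L" if "z \<in> set P" for z
    using P(2) pr'(6) that st'(3) by (auto dest: cutD)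
  have old: "head D z \<in> S \<or> z \<in> X \<or> z \<in> L" if "l \<in> L0" "z \<in> set (c l)" for l z
    using sg'(8)[OF that] sg'(7)[OF that(1)] by (auto split: if_splits)
  have new: "z \<notin> set (c l')" if z: "tail D z \<notin> S" "head D z \<notin> S" "z \<notin> X" "z \<notin> L" "l' \<in> L0" for z l'
    using old[OF z(5)] z by blast
  have qX: "z \<notin> X" if "l \<in> ?O" "z \<in> set (q l)" for l z using eY(4)[OF that] XY(1) by auto
  have nL0: "z \<notin> L0" if "tail D z \<notin> S" for z using that L0 sg'(3) by (auto dest: cutD)
  have sub: "set (c' l) \<subseteq> set (c l) \<union> (if l = l0 then set P else if l \<in> ?O then set (q l) else {})"
    if "l \<in> L0" for l using cases[OF that] c'F c'0 c'O by auto
  have sub0: "set (c l) \<subseteq> set (c' l)" for l unfolding c'_def by auto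
  have fresh: "tail D z \<notin> S \<and> head D z \<notin> S \<and> z \<notin> X \<and> z \<notin> L" if "l \<in> L0" "z \<in> set (c' l)" "z \<notin> set (c l)" for l z
    using sub[OF that(1)] that(2,3) eY[of l z] PP[of z] qX[of l z] by (auto split: if_splits)
  have disj: "set (c' l) \<inter> set (c' l') = {}" if l: "l \<in> L0" "l' \<in> L0" "l \<noteq> l'" for l l'
  proof (rule ccontr)
    assume "\<not> ?thesis"
    then obtain z where z: "z \<in> set (c' l)" "z \<in> set (c' l')" by auto
    have n: "z \<notin> set (c l)" "z \<notin> set (c l')"
      using fresh[OF l(1) z(1)] fresh[OF l(2) z(2)] new l(1,2) sg'(9)[OF l] by blast+
    show False
    proof (cases "l = l0 \<or> l' = l0")
      case True
      then show False using sub[OF l(1)] sub[OF l(2)] z n l(3) PP(3)[of z] eY(4)[of l z] eY(4)[of l' z]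
        by (auto split: if_splits)
    next
      case False
      then have O: "l \<in> ?O" "l' \<in> ?O" "z \<in> set (q l)" "z \<in> set (q l')"
        using sub[OF l(1)] sub[OF l(2)] z n by (auto split: if_splits)
      then have "d l = d l'"
        using pred_rel_root_unique[of z "d l" "L - {e}" U p "d l'"] aq[OF O(1)] aq[OF O(2)] dL by blast
      moreover have "d l \<in> set (c l)" "d l' \<in> set (c l')" using sg'(7)[of l] sg'(7)[of l'] O by auto
      ultimately show False using sg'(9)[OF l] by auto
    qed
  qed
  have "indep N ((\<Union>l\<in>L0. set (c' l)) \<union> Y)"
  proof (rule indep_localI)
    have a1: "set (c l) \<subseteq> arcs D" if "l \<in> L0" for l
      using indep_subset_ground[OF sg'(10)] that ground_N by auto
    have a2: "set P \<subseteq> arcs D" using P(2) stateD(4)[OF stT] by auto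
    have a3: "set (q l) \<subseteq> arcs D" if "l \<in> ?O" for l using eY(3)[OF that] k'(4) by auto
    have "set (c' l) \<subseteq> arcs D" if l: "l \<in> L0" for l
      by (rule subset_trans[OF sub[OF l]]) (use a1[OF l] a2 a3[of l] in auto)
    then show "(\<Union>l\<in>L0. set (c' l)) \<union> Y \<subseteq> arcs D" using stateD(4)[OF stT] by auto
    fix v
    show "\<exists>K. indep N K \<and> ((\<Union>l\<in>L0. set (c' l)) \<union> Y) \<inter> {a. head D a = v} \<subseteq> K"
    \<comment> \<open>Heads in \<open>S\<close> see only edges of the old stage. All edges
      considered whose head lies outside \<open>S\<close> belong to \<open>U \<union> Y\<close>,
      which the wave makes independent.\<close>
    proof (cases "v \<in> S")
      case True
      have "((\<Union>l\<in>L0. set (c' l)) \<union> Y) \<inter> {a. head D a = v} \<subseteq> (\<Union>l\<in>L0. set (c l)) \<union> X"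
        using fresh pr'(6) True by blast
      then show ?thesis using sg'(10) by blast
    next
      case False
      have "z \<in> U \<union> Y" if z: "l \<in> L0" "z \<in> set (c' l)" "head D z \<notin> S" for l z
      proof (cases "z \<in> set (c l)")
        case True
        then have 1: "if l \<in> F then z \<in> X else z = d l" using sg'(8)[OF z(1) True] z(3) by blast
        consider "l \<in> F" | "l = l0" | "l \<in> ?O" using cases[OF z(1)] by blast
        then show ?thesis
        proof cases
          case 1
          then show ?thesis using \<open>if l \<in> F then z \<in> X else z = d l\<close> XY(1) by auto
        next
          case 2
          then show ?thesis using \<open>if l \<in> F then z \<in> X else z = d l\<close> l0 XY(2) unfolding e_def by auto
        next
          case 3
          then have "z = d l" using \<open>if l \<in> F then z \<in> X else z = d l\<close> by auto
          then show ?thesis using pred_rel_rtrancl_in[OF lk] aq[OF 3] by blast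
        qed
      next
        case False
        then show ?thesis using sub[OF z(1)] z(2) PP(3)[of z] eY(3)[of l z] by (auto split: if_splits)
      qed
      then have "((\<Union>l\<in>L0. set (c' l)) \<union> Y) \<inter> {a. head D a = v} \<subseteq> U \<union> Y" using False by blast
      then show ?thesis using k'(10) by blast
    qed
  qed
  moreover have "l \<in> set (c' l) \<and> set (c' l) \<inter> L0 \<subseteq> {l}" if l: "l \<in> L0" for l
    using sg'(4,5)[OF l] sub0[of l] fresh[OF l] nL0 by blast
  moreover have "if l \<in> insert l0 F then cas s (c' l) t
       else cas s (c' l) (head D (a l)) \<and> a l \<in> U \<inter> cut T \<and> a l \<in> set (c' l)" if l: "l \<in> L0" for l
  proof -
    consider "l \<in> F" | "l = l0" | "l \<in> ?O" using cases[OF l] by blast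
    then show ?thesis
    proof cases
      case 1
      then show ?thesis using sg'(6)[OF l] c'F by simp
    next
      case 2
      then show ?thesis using cas_append[OF e(2) P(1)] c'0 by simp
    next
      case 3
      then have "cas s (c' l) (head D (a l))"
        using cas_append[of s "c l" "head D (d l)"] sg'(7)[OF l] aq[OF 3] c'O[OF 3] by auto
      moreover have "a l \<in> set (c' l)" using aq[OF 3] c'O[OF 3] sg'(7)[OF l] 3 by auto
      ultimately show ?thesis using aq[OF 3] 3 by auto
    qed
  qed
  moreover have "head D z \<in> T \<or> (if l \<in> insert l0 F then z \<in> Y else z = a l)"
    if l: "l \<in> L0" and z: "z \<in> set (c' l)" for l z
  proof -
    consider "l \<in> F" | "l = l0" | "l \<in> ?O" using cases[OF l] by blast
    then show ?thesis
    proof cases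
      case 1
      then show ?thesis using sg'(8)[OF l, of z] z c'F[OF 1] XY(1) k'(1) by auto
    next
      case 2
      then show ?thesis using sg'(8)[OF l, of z] z c'0 XY(2) k'(1) l0 PP(3)[of z] unfolding e_def by auto
    next
      case 3
      then have "head D z \<in> S \<or> (a l, z) \<in> ?R"
        using sg'(8)[OF l, of z] z c'O[OF 3] aq[OF 3] by auto
      then have "head D z \<in> T \<or> z = a l"
        using pred_rel_rtrancl_head[OF lk _ k'(6)] k'(1) by blast
      then show ?thesis using 3 by auto
    qed
  qed
  ultimately have "stage s S0 L0 T (U \<inter> cut T) Y (insert l0 F) c' a"
    unfolding stage_def using stT pr'(3) sg'(3) k'(1) disj by blast
  then show ?thesis using that c'F by blast
qed

lemma cas_crosses_cut:
  "cas u p v \<Longrightarrow> set p \<subseteq> arcs D \<Longrightarrow> u \<in> S \<Longrightarrow> v \<notin> S \<Longrightarrow> \<exists>a\<in>set p. a \<in> cut S"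
proof (induction p arbitrary: u)
  case (Cons a p)
  show ?case
  proof (cases "head D a \<in> S")
    case True
    then show ?thesis using Cons.IH[of "head D a"] Cons.prems by auto
  next
    case False
    then show ?thesis using Cons.prems by (auto simp: cut_def)
  qed
qed simp

text \<open>A finished walk never changes again, so each root gets a final walk \<open>cw l\<close>.
  Any two of these walks, and any finitely many of their edges, occur at a common stage; this gives
  disjointness and, by finite character, independence.\<close>

lemma linkage:
  assumes s: "s \<in> verts D" "s \<noteq> t"
  obtains S0 L0 c where "s \<in> S0" "t \<notin> S0" "indep N L0" "cut S0 \<subseteq> cl L0"
    "\<And>l. l \<in> L0 \<Longrightarrow> cas s (c l) t \<and> l \<in> set (c l) \<and> set (c l) \<inter> L0 \<subseteq> {l}"
    "\<And>l l'. l \<in> L0 \<Longrightarrow> l' \<in> L0 \<Longrightarrow> l \<noteq> l' \<Longrightarrow> set (c l) \<inter> set (c l') = {}"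
    "indep N (\<Union>l\<in>L0. set (c l))"
proof -
  obtain S0 L0 c0 d0 where S0: "s \<in> S0" "t \<notin> S0" "L0 \<subseteq> cut S0" "indep N L0" "cut S0 \<subseteq> cl L0"
    and c0: "stage s S0 L0 S0 L0 {} {} c0 d0"
    by (rule initial_stage[OF s])
  define a where "a n = from_nat_into L0 n" for n
  define Q where "Q w \<longleftrightarrow> (case w of (F, c) \<Rightarrow> \<exists>S L X d. stage s S0 L0 S L X F c d)" for w
  define E where "E n w w' \<longleftrightarrow> (case w of (F, c) \<Rightarrow> case w' of (F', c') \<Rightarrow>
    F \<subseteq> F' \<and> (\<forall>l\<in>F. c' l = c l) \<and> (a n \<in> L0 \<longrightarrow> a n \<in> F'))" for n and w w' :: "'e set \<times> ('e \<Rightarrow> 'e list)"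
  have "Q ({}, c0)" unfolding Q_def using c0 by blast
  then have ex0: "\<exists>w. Q w" by blast
  have exS: "\<exists>w'. Q w' \<and> E n w w'" if Qw: "Q w" for w n
  proof -
    obtain F c where w: "w = (F, c)" by (cases w)
    obtain S L X d where sg: "stage s S0 L0 S L X F c d" using Qw unfolding Q_def w by auto
    show ?thesis
    proof (cases "a n \<in> L0 \<and> a n \<notin> F")
      case True
      then obtain S' L' X' c' d' where "stage s S0 L0 S' L' X' (insert (a n) F) c' d'"
        "\<And>l. l \<in> F \<Longrightarrow> c' l = c l"
        using stage_step[OF sg _ _ S0(3), of "a n"] by metis
      then show ?thesis unfolding Q_def E_def w by (intro exI[of _ "(insert (a n) F, c')"]) auto
    next
      case False
      then show ?thesis using sg unfolding Q_def E_def w by (intro exI[of _ "(F, c)"]) auto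
    qed
  qed
  obtain g where g: "\<And>n. Q (g n)" "\<And>n. E n (g n) (g (Suc n))"
    using dependent_nat_choice[of "\<lambda>_. Q" E] ex0 exS by metis
  define F where "F n = fst (g n)" for n
  define c where "c n = snd (g n)" for n
  have gg: "g n = (F n, c n)" for n unfolding F_def c_def by simp
  have sg: "\<exists>S L X d. stage s S0 L0 S L X (F n) (c n) d" for n using g(1)[of n] unfolding Q_def gg by simp
  have step: "F n \<subseteq> F (Suc n)" "\<And>l. l \<in> F n \<Longrightarrow> c (Suc n) l = c n l" "a n \<in> L0 \<Longrightarrow> a n \<in> F (Suc n)" for n
    using g(2)[of n] unfolding E_def gg by auto
  have mono: "F m \<subseteq> F n" if "m \<le> n" for m n using lift_Suc_mono_le[of F, OF step(1) that] .
  have stable: "c n l = c m l" if "m \<le> n" "l \<in> F m" for m n l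
    using that(1)
  proof (induction n rule: dec_induct)
    case (step n)
    then show ?case using step(2) mono[OF step(1)] that(2) \<open>\<And>n l. l \<in> F n \<Longrightarrow> c (Suc n) l = c n l\<close> by auto
  qed simp
  have fin: "\<exists>n. l \<in> F n" if l: "l \<in> L0" for l
  proof -
    have "countable L0" using countable_subset[OF _ countable_arcs] S0(3) cutD(1) by blast
    then obtain n where "a n = l"
      using range_from_nat_into[of L0] l unfolding a_def by (metis empty_iff imageE)
    then show ?thesis using step(3)[of n] l by auto
  qed
  define k where "k l = (SOME n. l \<in> F n)" for l
  define cw where "cw l = c (k l) l" for l
  have k: "l \<in> F (k l)" if "l \<in> L0" for l using someI_ex[OF fin[OF that]] unfolding k_def .
  have cw: "cw l = c n l" if "l \<in> L0" "k l \<le> n" for l n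
    using stable[OF that(2) k[OF that(1)]] unfolding cw_def by simp
  have 1: "cas s (cw l) t \<and> l \<in> set (cw l) \<and> set (cw l) \<inter> L0 \<subseteq> {l}" if l: "l \<in> L0" for l
  proof -
    obtain S L X d where sg': "stage s S0 L0 S L X (F (k l)) (c (k l)) d" using sg by blast
    show ?thesis using stageD(4-6)[OF sg' l] k[OF l] unfolding cw_def by blast
  qed
  have 2: "set (cw l) \<inter> set (cw l') = {}" if l: "l \<in> L0" "l' \<in> L0" "l \<noteq> l'" for l l'
  proof -
    define n where "n = max (k l) (k l')"
    obtain S L X d where sg': "stage s S0 L0 S L X (F n) (c n) d" using sg by blast
    show ?thesis using stageD(9)[OF sg' l] cw[of l n] cw[of l' n] l unfolding n_def by simp
  qed
  have 3: "indep N (\<Union>l\<in>L0. set (cw l))"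
  proof (rule indep_finite_character)
    have sub: "set (cw l) \<subseteq> ground N" if l: "l \<in> L0" for l
    proof -
      obtain S L X d where sg': "stage s S0 L0 S L X (F (k l)) (c (k l)) d" using sg by blast
      show ?thesis using indep_subset_ground[OF stageD(10)[OF sg']] l unfolding cw_def by auto
    qed
    then show "(\<Union>l\<in>L0. set (cw l)) \<subseteq> ground N" by auto
    fix H assume H: "finite H" "H \<subseteq> (\<Union>l\<in>L0. set (cw l))"
    then have "\<forall>h\<in>H. \<exists>l. l \<in> L0 \<and> h \<in> set (cw l)" by auto
    from bchoice[OF this] obtain r where r: "\<forall>h\<in>H. r h \<in> L0 \<and> h \<in> set (cw (r h))" by blast
    define n where "n = Max (insert 0 ((\<lambda>h. k (r h)) ` H))"
    have n: "k (r h) \<le> n" if "h \<in> H" for h unfolding n_def using H(1) that by (intro Max_ge) auto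
    obtain S L X d where sg': "stage s S0 L0 S L X (F n) (c n) d" using sg by blast
    have "H \<subseteq> (\<Union>l\<in>L0. set (c n l)) \<union> X"
    proof
      fix h assume h: "h \<in> H"
      then have "h \<in> set (c n (r h))" using r cw[of "r h" n] n[OF h] by auto
      then show "h \<in> (\<Union>l\<in>L0. set (c n l)) \<union> X" using r h by auto
    qed
    then show "indep N H" by (rule indep_subset[OF stageD(10)[OF sg']])
  qed
  show ?thesis by (rule that[OF S0(1,2,4,5) 1 2 3])
qed

end

section \<open>Direct sums, and the passage from walks to paths\<close>

lemma circuit_direct_sum:
  assumes mat: "\<And>i. i \<in> I \<Longrightarrow> matroid (M i)" and C: "circuit (direct_sum I M) C"
  obtains i where "i \<in> I" "circuit (M i) C"
proof -
  have sub: "C \<subseteq> (\<Union>i\<in>I. ground (M i))" and dep: "\<not> indep (direct_sum I M) C"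
    and min: "\<And>K. K \<subset> C \<Longrightarrow> indep (direct_sum I M) K"
    using C unfolding circuit_def by auto
  obtain i where i: "i \<in> I" "\<not> indep (M i) (C \<inter> ground (M i))"
    using sub dep unfolding indep_direct_sum by auto
  have local: "indep (M i) (K \<inter> ground (M i))" if "K \<subset> C" for K
    using min[OF that] i(1) unfolding indep_direct_sum by auto
  have Ci: "C \<subseteq> ground (M i)"
  proof (rule ccontr)
    assume "\<not> C \<subseteq> ground (M i)"
    then have "C \<inter> ground (M i) \<subset> C" by auto
    from local[OF this] show False using i(2) by (simp add: Int_assoc)
  qed
  have "indep (M i) K" if "K \<subset> C" for K
  proof -
    have "K \<inter> ground (M i) = K" using that Ci by auto
    then show ?thesis using local[OF that] by simp
  qed
  moreover have "C \<inter> ground (M i) = C" using Ci by auto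
  ultimately have "circuit (M i) C" unfolding circuit_def using i(2) Ci by auto
  then show ?thesis using that i(1) by blast
qed

theorem theorem3:
  fixes D :: "('v, 'e) pre_digraph"
    and s t :: 'v
    and M :: "'v \<Rightarrow> 'e matroid_data"
  assumes "wf_digraph D"
    and "countable (verts D)" and "countable (arcs D)"
    and "s \<in> verts D" and "t \<in> verts D" and "s \<noteq> t"
    and "\<And>v. v \<in> verts D \<Longrightarrow> finitary_matroid (M v)"
    and "\<And>v. v \<in> verts D \<Longrightarrow> ground (M v) = in_arcs D v"
  shows "\<exists>\<P> C.
    (\<forall>P\<in>\<P>. pre_digraph.apath D s P t) \<and>
    (\<forall>P\<in>\<P>. \<forall>Q\<in>\<P>. P \<noteq> Q \<longrightarrow> set P \<inter> set Q = {}) \<and>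
    indep (direct_sum (verts D) M) (\<Union>P\<in>\<P>. set P) \<and>
    C \<subseteq> (\<Union>P\<in>\<P>. set P) \<and>
    (\<forall>P\<in>\<P>. \<exists>!e. e \<in> C \<and> e \<in> set P) \<and>
    (\<forall>Q. pre_digraph.apath D s Q t \<longrightarrow> set Q \<inter> matroid_span (direct_sum (verts D) M) C \<noteq> {})"
proof -
  interpret wf_digraph D by (rule assms(1))
  let ?N = "direct_sum (verts D) M"
  have mat: "matroid (M v)" if "v \<in> verts D" for v
    using assms(7)[OF that] by (rule finitary_matroid.axioms(1))
  have gr: "ground ?N = arcs D" using assms(8) by (auto simp: in_arcs_def)
  have "matroid ?N"
    by (rule matroid_direct_sum[OF mat]) (use assms(8) in \<open>auto simp: in_arcs_def\<close>)
  then interpret matroid_network D ?N t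
  proof (intro matroid_network.intro matroid_network_axioms.intro finitary_matroid.intro
      finitary_matroid_axioms.intro)
    show "wf_digraph D" by (rule assms(1))
    show "finite C" if C: "circuit ?N C" for C
    proof -
      obtain v where "v \<in> verts D" "circuit (M v) C" using circuit_direct_sum[OF mat C] by blast
      then show ?thesis using finitary_matroid.circuit_finite[OF assms(7)] by blast
    qed
    show "ground ?N = arcs D" by (rule gr)
    show "indep ?N J" if J: "J \<subseteq> arcs D" "\<And>v. indep ?N (J \<inter> {a. head D a = v})" for J
    proof -
      have "indep (M v) (J \<inter> ground (M v))" if v: "v \<in> verts D" for v
      proof -
        have "indep (M v) (J \<inter> {a. head D a = v} \<inter> ground (M v))"
          using J(2)[of v] v unfolding indep_direct_sum by blast
        moreover have "J \<inter> {a. head D a = v} \<inter> ground (M v) = J \<inter> ground (M v)"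
          using assms(8)[OF v] by (auto simp: in_arcs_def)
        ultimately show ?thesis by simp
      qed
      then show ?thesis using J(1) gr unfolding indep_direct_sum by auto
    qed
  qed (use assms(2,3) in auto)
  obtain S0 L0 c where S0: "s \<in> S0" "t \<notin> S0" and L0: "indep ?N L0" "cut S0 \<subseteq> cl L0"
    and c: "\<And>l. l \<in> L0 \<Longrightarrow> cas s (c l) t \<and> l \<in> set (c l) \<and> set (c l) \<inter> L0 \<subseteq> {l}"
    and disj: "\<And>l l'. l \<in> L0 \<Longrightarrow> l' \<in> L0 \<Longrightarrow> l \<noteq> l' \<Longrightarrow> set (c l) \<inter> set (c l') = {}"
    and ind: "indep ?N (\<Union>l\<in>L0. set (c l))"
    using linkage[OF assms(4,6)] by blast
  define P where "P l = awalk_to_apath (c l)" for l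
  have aw: "awalk s (c l) t" if l: "l \<in> L0" for l
    unfolding awalk_def using c[OF l] assms(4) indep_subset_ground[OF ind] gr l by auto
  have Papath: "apath s (P l) t" and Psub: "set (P l) \<subseteq> set (c l)" if l: "l \<in> L0" for l
    unfolding P_def using apath_awalk_to_apath[OF aw[OF l]] awalk_to_apath_subset[OF aw[OF l]] by auto
  have cover: "set Q \<inter> matroid_span ?N L0 \<noteq> {}" if "apath s Q t" for Q
  proof -
    have "cas s Q t" "set Q \<subseteq> arcs D" using that unfolding apath_def awalk_def by auto
    then obtain a where "a \<in> set Q" "a \<in> cut S0" using cas_crosses_cut S0 by blast
    then show ?thesis using L0(2) cl_subset_span[OF L0(1)] by blast
  qed
  have L0sub: "L0 \<subseteq> (\<Union>l\<in>L0. set (c l))" using c by auto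
  \<comment> \<open>Shortening might drop \<open>l\<close>. But the path still crosses
    \<open>cut S0\<close> and so meets the span of \<open>L0\<close>; within the independent union
    that span is just \<open>L0\<close>, and \<open>l\<close> is the only member of
    \<open>L0\<close> on \<open>c l\<close>.\<close>
  have lP: "l \<in> set (P l)" if l: "l \<in> L0" for l
  proof -
    obtain a where a: "a \<in> set (P l)" "a \<in> matroid_span ?N L0" using cover[OF Papath[OF l]] by blast
    then have "a \<in> (\<Union>l\<in>L0. set (c l))" using Psub[OF l] l by auto
    then have "a \<in> L0" using span_Int_indep[OF ind L0sub] a(2) by blast
    then have "a = l" using a(1) Psub[OF l] c[OF l] by blast
    then show ?thesis using a(1) by simp
  qed
  have "indep ?N (\<Union>Q\<in>P ` L0. set Q)"
    by (rule indep_subset[OF ind]) (use Psub in auto)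
  moreover have "set Q \<inter> set Q' = {}" if QQ: "Q \<in> P ` L0" "Q' \<in> P ` L0" "Q \<noteq> Q'" for Q Q'
  proof -
    obtain l l' where l: "l \<in> L0" "l' \<in> L0" "Q = P l" "Q' = P l'" "l \<noteq> l'" using QQ by auto
    then show ?thesis using disj[OF l(1,2,5)] Psub[OF l(1)] Psub[OF l(2)] by auto
  qed
  moreover have "\<exists>!e. e \<in> L0 \<and> e \<in> set Q" if Q: "Q \<in> P ` L0" for Q
  proof -
    obtain l where l: "l \<in> L0" "Q = P l" using Q by auto
    show ?thesis
      by (rule ex1I[of _ l]) (use l lP[OF l(1)] Psub[OF l(1)] c[OF l(1)] in auto)
  qed
  moreover have "L0 \<subseteq> (\<Union>Q\<in>P ` L0. set Q)" using lP by auto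
  ultimately show ?thesis
    using Papath cover by (intro exI[of _ "P ` L0"] exI[of _ L0]) auto
qed

end
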